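(* Let $\theta_{1,t}(\tau)=\tau+t$ for $t,\tau\in\mathbb{R}$, let $(\Omega_2,\mathcal{F}_2,P,\{\theta_{2,t}\}_{t\in\mathbb{R}})$ be a parametric dynamical system, and let $\Phi:\mathbb{R}^+\times\mathbb{R}\times\Omega_2\times\ell^2\to\ell^2$ be a continuous cocycle on $\ell^2$ over $(\mathbb{R},\{\theta_{1,t}\}_{t\in\mathbb{R}})$ and $(\Omega_2,\mathcal{F}_2,P,\{\theta_{2,t}\}_{t\in\mathbb{R}})$. Suppose that (a) there exists a closed measurable (with respect to the $P$-completion of $\mathcal{F}_2$) $\mathcal{D}(\ell^2)$-pullback absorbing set $K=\{K(\tau,\omega)\}$ in $\mathcal{D}(\ell^2)$ such that for a.e. $\tau\in\mathbb{R}$, $\omega\in\Omega_2$ and any $B=\{B(\tau,\omega)\}\in\mathcal{D}(\ell^2)$ there exists $T_B(\tau,\omega)>0$ with $$\Phi(t,\tau-t,\theta_{2,-t}\omega,B(\tau-t,\theta_{2,-t}\omega))\subset K(\tau,\omega)\quad\text{for all } t\ge T_B(\tau,\omega);$$ (b) $\Phi$ is asymptotically null on $K$, i.e., for a.e. $\tau\in\mathbb{R}$, $\omega\in\Omega_2$ and any $\varepsilon>0$ there exist $T(\varepsilon,\tau,\omega,K)>0$ and $I_0(\varepsilon,\tau,\omega,K)\in\mathbb{N}$ such that $$\sup_{u\in K(\tau-t,\theta_{2,-t}\omega)}\ \sum_{|i|>I_0(\varepsilon,\tau,\omega,K)}\big|(\Phi(t,\tau-t,\theta_{2,-t}\omega,u))_i\big|^2\le\varepsilon^2\quad\text{for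 all } t\ge T(\varepsilon,\tau,\omega,K).$$ Then: (i) $\Phi$ possesses a unique $\mathcal{D}(\ell^2)$-pullback attractor $\mathcal{A}=\{\mathcal{A}(\tau,\omega)\}$, given for each $\tau\in\mathbb{R}$ and $\omega\in\Omega_2$ by $$\mathcal{A}(\tau,\omega)=\bigcap_{s\ge T_K(\tau,\omega)}\overline{\bigcup_{t\ge s}\Phi(t,\tau-t,\theta_{2,-t}\omega,K(\tau-t,\theta_{2,-t}\omega))},$$ where $T_K(\tau,\omega)$ is the time from (a) for $B=K$; (ii) the Kolmogorov $\varepsilon$-entropy of $\mathcal{A}(\tau,\omega)$ satisfies $$\mathbb{K}_\varepsilon(\mathcal{A}(\tau,\omega))\le(2I_0+1)\ln\left(\left\lfloor\frac{2r_0(\tau,\omega)\sqrt{2I_0+1}}{\varepsilon}\right\rfloor+1\right),\qquad I_0=I_0(\varepsilon,\tau,\omega,K),$$ where $r_0(\tau,\omega)=\sup_{u\in K(\tau,\omega)}\|u\|$ for all $\tau\in\mathbb{R}$, $\omega\in\Omega_2$.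
   Context: $\ell^2$ is the Hilbert space of real sequences $u=(u_i)_{i\in\mathbb{Z}}$ with $\|u\|^2=\sum_i|u_i|^2<\infty$. Parametric dynamical system $(\Omega_2,\mathcal{F}_2,P,\{\theta_{2,t}\}_{t\in\mathbb{R}})$: $(\Omega_2,\mathcal{F}_2,P)$ is a probability space, $(t,\omega)\mapsto\theta_{2,t}\omega$ is $(\mathcal{B}(\mathbb{R})\times\mathcal{F}_2,\mathcal{F}_2)$-measurable, $\theta_{2,0}=\mathrm{id}$, $\theta_{2,s+t}=\theta_{2,t}\theta_{2,s}$ and each $\theta_{2,t}$ preserves $P$. Continuous cocycle on $\ell^2$ over $(\mathbb{R},\{\theta_{1,t}\})$ and $(\Omega_2,\mathcal{F}_2,P,\{\theta_{2,t}\})$: a map $\Phi:\mathbb{R}^+\times\mathbb{R}\times\Omega_2\times\ell^2\to\ell^2$ such that for all $\tau\in\mathbb{R}$, $\omega\in\Omega_2$, $t,s\in\mathbb{R}^+$: $\Phi(\cdot,\tau,\cdot,\cdot)$ is $(\mathcal{B}(\mathbb{R}^+)\times\mathcal{F}_2\times\mathcal{B}(\ell^2),\mathcal{B}(\ell^2))$-measurable; $\Phi(0,\tau,\omega,\cdot)=\mathrm{id}$; $\Phi(t+s,\tau,\omega,\cdot)=\Phi(t,\tau+s,\theta_{2,s}\omega,\cdot)\circ\Phi(s,\tau,\omega,\cdot)$; $\Phi(t,\tau,\omega,\cdot)$ is continuous. $\mathcal{D}(\ell^2)$ is the collection of all families $D=\{D(\tau,\omega):\tau\in\mathbb{R},\omega\in\Omega_2\}$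 of bounded nonempty subsets of $\ell^2$ such that for every $\gamma>0$, $\lim_{s\to+\infty}e^{-\gamma s}\|D(\tau-s,\theta_{2,-s}\omega)\|^2=0$, where $\|D\|=\sup_{u\in D}\|u\|$ for a bounded set $D$. A family $K=\{K(\tau,\omega)\}$ of closed nonempty sets is measurable w.r.t. a $\sigma$-algebra $\mathcal{G}$ on $\Omega_2$ if $\omega\mapsto d(x,K(\tau,\omega))$ is $(\mathcal{G},\mathcal{B}(\mathbb{R}))$-measurable for every $x\in\ell^2$, $\tau\in\mathbb{R}$. A closed measurable $\mathcal{D}(\ell^2)$-pullback absorbing set is a family $K\in\mathcal{D}(\ell^2)$ of closed nonempty sets, measurable w.r.t. the $P$-completion of $\mathcal{F}_2$, such that for all $\tau\in\mathbb{R}$, $\omega\in\Omega_2$ and every $B\in\mathcal{D}(\ell^2)$ there is $T=T(B,\tau,\omega)>0$ with $\Phi(t,\tau-t,\theta_{2,-t}\omega,B(\tau-t,\theta_{2,-t}\omega))\subseteq K(\tau,\omega)$ for all $t\ge T$. A $\mathcal{D}(\ell^2)$-pullback attractor for $\Phi$ is a family $\mathcal{A}\in\mathcal{D}(\ell^2)$ such that: $\mathcal{A}$ is measurable w.r.t. the $P$-completion of $\mathcal{F}_2$ and each $\mathcal{A}(\tau,\omega)$ is compact; $\Phi(t,\tau,\omega,\mathcal{A}(\tau,\omega))=\mathcal{A}(\tau+t,\theta_{2,t}\omega)$ for all $t\ge0$; and for every $B\in\mathcal{D}(\ell^2)$ and all $\tau,\omega$, $\lim_{t\to\infty}d(\Phi(t,\tau-t,\theta_{2,-t}\omega,B(\tau-t,\theta_{2,-t}\omega)),\mathcal{A}(\tau,\omega))=0$,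 where $d(Y,Z)=\sup_{y\in Y}\inf_{z\in Z}\|y-z\|$. Kolmogorov $\varepsilon$-entropy of a subset $Y$ of a Banach space $X$: $\mathbb{K}_\varepsilon(Y)=\ln n_\varepsilon(Y)\in[0,+\infty]$, where $n_\varepsilon(Y)$ is the minimal number $n\ge1$ of open balls of radius $\varepsilon$ in $X$ (arbitrary centres) covering $Y$.
   Formalization: In (ii) the bound fails for an arbitrary index I_0 from (b) at ε; it is proved for some I_0 valid in (b) at ε (a.e. τ, all ω), and for every I_0 satisfying (b) with ε/2 in place of ε. "A.e. τ, ω" is read as a.e. τ and every ω. *)

theory Defs
  imports "HOL-Probability.Probability"
begin

section \<open>The Hilbert space of square-summable real sequences indexed by the integers\<close>

typedef ell2 = "{u :: int \<Rightarrow> real. (\<lambda>i. \<bar>u i\<bar>\<^sup>2) summable_on UNIV}"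
  morphisms coord Abs_ell2
  by (rule exI[of _ "\<lambda>_. 0"]) simp

setup_lifting type_definition_ell2

lemma coord_sq_summable: "(\<lambda>i. (coord u i)\<^sup>2) summable_on A"
  using coord[of u] summable_on_subset_banach[of "\<lambda>i. (coord u i)\<^sup>2" UNIV A] by simp

lemma ell2_eqI: "(\<And>i. coord u i = coord v i) \<Longrightarrow> u = v"
  by (metis coord_inject ext)

lemma coord_Abs_ell2: "(\<lambda>i. (f i)\<^sup>2) summable_on UNIV \<Longrightarrow> coord (Abs_ell2 f) = f"
  by (simp add: Abs_ell2_inverse)

lemma sq_summable_add:
  fixes f g :: "int \<Rightarrow> real"
  assumes "(\<lambda>i. (f i)\<^sup>2) summable_on A" "(\<lambda>i. (g i)\<^sup>2) summable_on A"
  shows "(\<lambda>i. (f i + g i)\<^sup>2) summable_on A"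
proof (rule summable_on_comparison_test)
  show "(\<lambda>i. 2 * (f i)\<^sup>2 + 2 * (g i)\<^sup>2) summable_on A"
    using assms by (intro summable_on_add summable_on_cmult_right)
  show "(f i + g i)\<^sup>2 \<le> 2 * (f i)\<^sup>2 + 2 * (g i)\<^sup>2" for i
    using sum_squares_bound[of "f i" "g i"] by (simp add: power2_sum)
qed simp

lemma sq_summable_scale:
  fixes f :: "int \<Rightarrow> real"
  assumes "(\<lambda>i. (f i)\<^sup>2) summable_on A"
  shows "(\<lambda>i. (c * f i)\<^sup>2) summable_on A"
  unfolding power_mult_distrib using assms by (rule summable_on_cmult_right)

lemma coord_mult_summable: "(\<lambda>i. coord u i * coord v i) summable_on A"
proof -
  have "(\<lambda>i. (coord u i)\<^sup>2 + (coord v i)\<^sup>2) summable_on A"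
    by (intro summable_on_add coord_sq_summable)
  moreover have "norm (coord u i * coord v i) \<le> (coord u i)\<^sup>2 + (coord v i)\<^sup>2" for i
  proof -
    have "2 * (\<bar>coord u i\<bar> * \<bar>coord v i\<bar>) \<le> (coord u i)\<^sup>2 + (coord v i)\<^sup>2"
      using sum_squares_bound[of "\<bar>coord u i\<bar>" "\<bar>coord v i\<bar>"] by (simp add: mult.assoc)
    moreover have "0 \<le> \<bar>coord u i\<bar> * \<bar>coord v i\<bar>" by simp
    ultimately show ?thesis by (simp only: real_norm_def abs_mult)
  qed
  ultimately have "(\<lambda>i. norm (coord u i * coord v i)) summable_on A"
    by (rule summable_on_comparison_test[where f = "\<lambda>i. (coord u i)\<^sup>2 + (coord v i)\<^sup>2"]) auto
  then show ?thesis by (rule abs_summable_summable)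
qed

instantiation ell2 :: real_vector
begin

lift_definition zero_ell2 :: ell2 is "\<lambda>_. 0" by simp
lift_definition plus_ell2 :: "ell2 \<Rightarrow> ell2 \<Rightarrow> ell2" is "\<lambda>u v i. u i + v i"
  using sq_summable_add[of _ UNIV] by simp
lift_definition scaleR_ell2 :: "real \<Rightarrow> ell2 \<Rightarrow> ell2" is "\<lambda>c u i. c * u i"
  using sq_summable_scale[of _ UNIV] by simp
lift_definition uminus_ell2 :: "ell2 \<Rightarrow> ell2" is "\<lambda>u i. - u i" by simp
lift_definition minus_ell2 :: "ell2 \<Rightarrow> ell2 \<Rightarrow> ell2" is "\<lambda>u v i. u i - v i"
  subgoal for u v using sq_summable_add[of u UNIV "\<lambda>i. - v i"] by simp
  done

instance
  by standard (transfer; simp add: algebra_simps)+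

end

lemmas coord_simps [simp] =
  zero_ell2.rep_eq plus_ell2.rep_eq scaleR_ell2.rep_eq uminus_ell2.rep_eq minus_ell2.rep_eq

instantiation ell2 :: real_inner
begin

definition inner_ell2 :: "ell2 \<Rightarrow> ell2 \<Rightarrow> real"
  where "inner_ell2 u v = (\<Sum>\<^sub>\<infinity>i. coord u i * coord v i)"
definition norm_ell2 :: "ell2 \<Rightarrow> real"
  where "norm_ell2 u = sqrt (\<Sum>\<^sub>\<infinity>i. \<bar>coord u i\<bar>\<^sup>2)"
definition dist_ell2 :: "ell2 \<Rightarrow> ell2 \<Rightarrow> real"
  where "dist_ell2 u v = norm (u - v)"
definition sgn_ell2 :: "ell2 \<Rightarrow> ell2"
  where "sgn_ell2 u = u /\<^sub>R norm u"
definition uniformity_ell2 :: "(ell2 \<times> ell2) filter"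
  where "uniformity_ell2 = (INF e\<in>{0<..}. principal {(x, y). dist x y < e})"
definition open_ell2 :: "ell2 set \<Rightarrow> bool"
  where "open_ell2 U \<longleftrightarrow> (\<forall>x\<in>U. \<forall>\<^sub>F (x', y) in uniformity. x' = x \<longrightarrow> y \<in> U)"

instance
proof
  fix x y z :: ell2 and r :: real
  show "inner x y = inner y x" by (simp add: inner_ell2_def mult.commute)
  show "inner (x + y) z = inner x z + inner y z"
    unfolding inner_ell2_def
    by (simp add: distrib_right infsum_add coord_mult_summable)
  show "inner (scaleR r x) y = r * inner x y"
    unfolding inner_ell2_def by (simp add: mult.assoc infsum_cmult_right')
  show "0 \<le> inner x x" unfolding inner_ell2_def by (rule infsum_nonneg) simp
  show "inner x x = 0 \<longleftrightarrow> x = 0"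
  proof
    assume *: "inner x x = 0"
    have "coord x i * coord x i = 0" for i
      by (rule nonneg_infsum_le_0D[of "\<lambda>i. coord x i * coord x i" UNIV])
        (use * coord_mult_summable in \<open>auto simp: inner_ell2_def\<close>)
    then show "x = 0" by (intro ell2_eqI) simp
  qed (simp add: inner_ell2_def)
  show "norm x = sqrt (inner x x)"
    by (simp add: norm_ell2_def inner_ell2_def power2_eq_square)
qed (simp_all add: dist_ell2_def sgn_ell2_def uniformity_ell2_def open_ell2_def)

end

lemma norm_ell2_sq: "(norm u)\<^sup>2 = (\<Sum>\<^sub>\<infinity>i. (coord u i)\<^sup>2)" for u :: ell2
  unfolding norm_ell2_def by (simp add: infsum_nonneg)

lemma sum_coord_sq_le: "finite F \<Longrightarrow> (\<Sum>i\<in>F. (coord u i)\<^sup>2) \<le> (norm u)\<^sup>2"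
  unfolding norm_ell2_sq by (rule finite_sum_le_infsum[OF coord_sq_summable]) auto

lemma abs_coord_le: "\<bar>coord u i\<bar> \<le> norm u"
  using sum_coord_sq_le[of "{i}" u] by (simp add: abs_le_square_iff[symmetric])

instance ell2 :: banach
proof
  fix X :: "nat \<Rightarrow> ell2"
  assume X: "Cauchy X"
  have "Cauchy (\<lambda>n. coord (X n) i)" for i
  proof (rule CauchyI)
    fix e :: real assume "0 < e"
    then obtain M where M: "\<And>m n. m \<ge> M \<Longrightarrow> n \<ge> M \<Longrightarrow> norm (X m - X n) < e"
      using CauchyD[OF X] by blast
    have "norm (coord (X m) i - coord (X n) i) < e" if "m \<ge> M" "n \<ge> M" for m n
      using M[OF that] abs_coord_le[of "X m - X n" i] by simp
    then show "\<exists>M. \<forall>m\<ge>M. \<forall>n\<ge>M. norm (coord (X m) i - coord (X n) i) < e" by blast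
  qed
  then have "\<exists>l. (\<lambda>n. coord (X n) i) \<longlonglongrightarrow> l" for i
    by (simp add: Cauchy_convergent_iff convergent_def)
  then obtain l where l: "\<And>i. (\<lambda>n. coord (X n) i) \<longlonglongrightarrow> l i" by metis
  have bound: "\<exists>M. \<forall>m\<ge>M. \<forall>F. finite F \<longrightarrow> (\<Sum>i\<in>F. (coord (X m) i - l i)\<^sup>2) \<le> e\<^sup>2"
    if "0 < e" for e :: real
  proof -
    obtain M where M: "\<And>m n. m \<ge> M \<Longrightarrow> n \<ge> M \<Longrightarrow> norm (X m - X n) < e"
      using CauchyD[OF X \<open>0 < e\<close>] by blast
    have "(\<Sum>i\<in>F. (coord (X m) i - l i)\<^sup>2) \<le> e\<^sup>2" if m: "m \<ge> M" and F: "finite F" for m F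
    proof (rule LIMSEQ_le_const2)
      show "(\<lambda>n. \<Sum>i\<in>F. (coord (X m) i - coord (X n) i)\<^sup>2)
          \<longlonglongrightarrow> (\<Sum>i\<in>F. (coord (X m) i - l i)\<^sup>2)"
        by (intro tendsto_intros l)
      have "(\<Sum>i\<in>F. (coord (X m) i - coord (X n) i)\<^sup>2) \<le> e\<^sup>2" if "n \<ge> M" for n
      proof -
        have "(\<Sum>i\<in>F. (coord (X m) i - coord (X n) i)\<^sup>2) \<le> (norm (X m - X n))\<^sup>2"
          using sum_coord_sq_le[OF F, of "X m - X n"] by simp
        also have "\<dots> \<le> e\<^sup>2" using M[OF m that] by (simp add: power_mono)
        finally show ?thesis .
      qed
      then show "\<exists>N. \<forall>n\<ge>N. (\<Sum>i\<in>F. (coord (X m) i - coord (X n) i)\<^sup>2) \<le> e\<^sup>2" by blast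
    qed
    then show ?thesis by blast
  qed
  have diff: "(\<lambda>i. (coord (X m) i - l i)\<^sup>2) summable_on UNIV"
    if "\<forall>F. finite F \<longrightarrow> (\<Sum>i\<in>F. (coord (X m) i - l i)\<^sup>2) \<le> e\<^sup>2" for m e
    by (rule nonneg_bdd_above_summable_on) (use that in \<open>auto intro!: bdd_aboveI2\<close>)
  obtain m0 where "\<forall>F. finite F \<longrightarrow> (\<Sum>i\<in>F. (coord (X m0) i - l i)\<^sup>2) \<le> 1\<^sup>2"
    using bound[of 1] by auto
  from sq_summable_add[OF coord_sq_summable[of "- X m0"] diff[OF this]]
  have "(\<lambda>i. (l i)\<^sup>2) summable_on UNIV" by simp
  then have L: "coord (Abs_ell2 l) = l" by (rule coord_Abs_ell2)
  have "X \<longlonglongrightarrow> Abs_ell2 l"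
  proof (rule LIMSEQ_I)
    fix r :: real assume "0 < r"
    then obtain M where
      M: "\<And>m F. m \<ge> M \<Longrightarrow> finite F \<Longrightarrow> (\<Sum>i\<in>F. (coord (X m) i - l i)\<^sup>2) \<le> (r / 2)\<^sup>2"
      using bound[of "r / 2"] by auto
    have "norm (X m - Abs_ell2 l) < r" if "m \<ge> M" for m
    proof -
      have "(norm (X m - Abs_ell2 l))\<^sup>2 \<le> (r / 2)\<^sup>2"
        unfolding norm_ell2_sq
        by (rule infsum_le_finite_sums[OF coord_sq_summable]) (use M[OF that] L in simp)
      then show ?thesis using \<open>0 < r\<close> power2_le_imp_le[of _ "r / 2"] by fastforce
    qed
    then show "\<exists>M. \<forall>m\<ge>M. norm (X m - Abs_ell2 l) < r" by blast
  qed
  then show "convergent X" by (auto simp: convergent_def)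
qed

section \<open>Parametric dynamical systems, cocycles and attractors\<close>

text \<open>
  The sample space is \<^term>\<open>space M\<close>, and the nonnegative times are the reals \<open>t \<ge> 0\<close>. All conditions
  on \<open>\<theta>\<close>, on \<open>\<Phi>\<close> and on families of sets are therefore restricted to these; values elsewhere are
  irrelevant.
\<close>

type_synonym 'w family = "real \<Rightarrow> 'w \<Rightarrow> ell2 set"

definition parametric_dynamical_system :: "'w measure \<Rightarrow> (real \<Rightarrow> 'w \<Rightarrow> 'w) \<Rightarrow> bool" where
  "parametric_dynamical_system M \<theta> \<longleftrightarrow>
     prob_space M \<and>
     (\<lambda>(t, \<omega>). \<theta> t \<omega>) \<in> borel \<Otimes>\<^sub>M M \<rightarrow>\<^sub>M M \<and>
     (\<forall>\<omega>\<in>space M. \<theta> 0 \<omega> = \<omega>) \<and>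
     (\<forall>s t. \<forall>\<omega>\<in>space M. \<theta> (s + t) \<omega> = \<theta> s (\<theta> t \<omega>)) \<and>
     (\<forall>t. distr M M (\<theta> t) = M)"

definition continuous_cocycle ::
  "'w measure \<Rightarrow> (real \<Rightarrow> 'w \<Rightarrow> 'w) \<Rightarrow> (real \<Rightarrow> real \<Rightarrow> 'w \<Rightarrow> ell2 \<Rightarrow> ell2) \<Rightarrow> bool" where
  "continuous_cocycle M \<theta> \<Phi> \<longleftrightarrow>
     (\<forall>\<tau>. (\<lambda>(t, \<omega>, u). \<Phi> t \<tau> \<omega> u) \<in>
            restrict_space borel {0..} \<Otimes>\<^sub>M (M \<Otimes>\<^sub>M borel) \<rightarrow>\<^sub>M borel) \<and>
     (\<forall>\<tau>. \<forall>\<omega>\<in>space M. \<forall>u. \<Phi> 0 \<tau> \<omega> u = u) \<and>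
     (\<forall>\<tau>. \<forall>\<omega>\<in>space M. \<forall>t\<ge>0. \<forall>s\<ge>0. \<forall>u.
            \<Phi> (t + s) \<tau> \<omega> u = \<Phi> t (\<tau> + s) (\<theta> s \<omega>) (\<Phi> s \<tau> \<omega> u)) \<and>
     (\<forall>\<tau>. \<forall>\<omega>\<in>space M. \<forall>t\<ge>0. continuous_on UNIV (\<Phi> t \<tau> \<omega>))"

definition set_norm :: "ell2 set \<Rightarrow> real" where
  "set_norm D = (SUP u\<in>D. norm u)"

definition tempered_families :: "'w measure \<Rightarrow> (real \<Rightarrow> 'w \<Rightarrow> 'w) \<Rightarrow> 'w family set" where
  "tempered_families M \<theta> = {D.
     (\<forall>\<tau>. \<forall>\<omega>\<in>space M. bounded (D \<tau> \<omega>) \<and> D \<tau> \<omega> \<noteq> {}) \<and>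
     (\<forall>\<tau>. \<forall>\<omega>\<in>space M. \<forall>\<gamma>>0.
        ((\<lambda>s. exp (- \<gamma> * s) * (set_norm (D (\<tau> - s) (\<theta> (- s) \<omega>)))\<^sup>2) \<longlongrightarrow> 0) at_top)}"

definition measurable_family :: "'w measure \<Rightarrow> 'w family \<Rightarrow> bool" where
  "measurable_family G K \<longleftrightarrow>
     (\<forall>\<tau>. \<forall>\<omega>\<in>space G. closed (K \<tau> \<omega>) \<and> K \<tau> \<omega> \<noteq> {}) \<and>
     (\<forall>x \<tau>. (\<lambda>\<omega>. infdist x (K \<tau> \<omega>)) \<in> G \<rightarrow>\<^sub>M borel)"

definition pullback_image ::
  "(real \<Rightarrow> 'w \<Rightarrow> 'w) \<Rightarrow> (real \<Rightarrow> real \<Rightarrow> 'w \<Rightarrow> ell2 \<Rightarrow> ell2) \<Rightarrow> 'w family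
    \<Rightarrow> real \<Rightarrow> real \<Rightarrow> 'w \<Rightarrow> ell2 set" where
  "pullback_image \<theta> \<Phi> B t \<tau> \<omega> =
     \<Phi> t (\<tau> - t) (\<theta> (- t) \<omega>) ` B (\<tau> - t) (\<theta> (- t) \<omega>)"

definition closed_measurable_pullback_absorbing_set ::
  "'w measure \<Rightarrow> (real \<Rightarrow> 'w \<Rightarrow> 'w) \<Rightarrow> (real \<Rightarrow> real \<Rightarrow> 'w \<Rightarrow> ell2 \<Rightarrow> ell2)
    \<Rightarrow> 'w family \<Rightarrow> bool" where
  "closed_measurable_pullback_absorbing_set M \<theta> \<Phi> K \<longleftrightarrow>
     K \<in> tempered_families M \<theta> \<and>
     measurable_family (completion M) K \<and>
     (\<forall>\<tau>. \<forall>\<omega>\<in>space M. \<forall>B\<in>tempered_families M \<theta>.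
        \<exists>T>0. \<forall>t\<ge>T. pullback_image \<theta> \<Phi> B t \<tau> \<omega> \<subseteq> K \<tau> \<omega>)"

text \<open>
  The suprema below are taken in \<open>[0, \<infinity>]\<close>, because \<open>\<Phi> t \<tau> \<omega>\<close> may map a bounded set to an
  unbounded one.
\<close>

definition hausdorff_semidist :: "ell2 set \<Rightarrow> ell2 set \<Rightarrow> ennreal" where
  "hausdorff_semidist Y Z = (SUP y\<in>Y. INF z\<in>Z. ennreal (norm (y - z)))"

definition pullback_attractor ::
  "'w measure \<Rightarrow> (real \<Rightarrow> 'w \<Rightarrow> 'w) \<Rightarrow> (real \<Rightarrow> real \<Rightarrow> 'w \<Rightarrow> ell2 \<Rightarrow> ell2)
    \<Rightarrow> 'w family \<Rightarrow> bool" where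
  "pullback_attractor M \<theta> \<Phi> A \<longleftrightarrow>
     A \<in> tempered_families M \<theta> \<and>
     measurable_family (completion M) A \<and>
     (\<forall>\<tau>. \<forall>\<omega>\<in>space M. compact (A \<tau> \<omega>)) \<and>
     (\<forall>\<tau>. \<forall>\<omega>\<in>space M. \<forall>t\<ge>0. \<Phi> t \<tau> \<omega> ` A \<tau> \<omega> = A (\<tau> + t) (\<theta> t \<omega>)) \<and>
     (\<forall>B\<in>tempered_families M \<theta>. \<forall>\<tau>. \<forall>\<omega>\<in>space M.
        ((\<lambda>t. hausdorff_semidist (pullback_image \<theta> \<Phi> B t \<tau> \<omega>) (A \<tau> \<omega>)) \<longlongrightarrow> 0) at_top)"

definition tail_bound ::
  "(real \<Rightarrow> 'w \<Rightarrow> 'w) \<Rightarrow> (real \<Rightarrow> real \<Rightarrow> 'w \<Rightarrow> ell2 \<Rightarrow> ell2) \<Rightarrow> 'w family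
    \<Rightarrow> real \<Rightarrow> real \<Rightarrow> 'w \<Rightarrow> real \<Rightarrow> nat \<Rightarrow> bool" where
  "tail_bound \<theta> \<Phi> K \<epsilon> \<tau> \<omega> T I\<^sub>0 \<longleftrightarrow>
     (\<forall>t\<ge>T. (SUP u\<in>K (\<tau> - t) (\<theta> (- t) \<omega>).
               ennreal (\<Sum>\<^sub>\<infinity>i\<in>{i. \<bar>i\<bar> > int I\<^sub>0}. \<bar>coord (\<Phi> t (\<tau> - t) (\<theta> (- t) \<omega>) u) i\<bar>\<^sup>2))
            \<le> ennreal (\<epsilon>\<^sup>2))"

text \<open>
  ``For a.e. \<open>\<tau>\<close>, \<open>\<omega>\<close>'' is read as: for Lebesgue-almost every \<open>\<tau>\<close> and for every \<open>\<omega>\<close>. Exceptional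
  sample points cannot be allowed here if a compact attractor is to exist over every \<open>\<omega>\<close>: with
  \<open>\<theta> t \<omega> = \<omega>\<close>, a single null sample point could carry a system without any compact attractor.
\<close>

definition asymptotically_null ::
  "'w measure \<Rightarrow> (real \<Rightarrow> 'w \<Rightarrow> 'w) \<Rightarrow> (real \<Rightarrow> real \<Rightarrow> 'w \<Rightarrow> ell2 \<Rightarrow> ell2)
    \<Rightarrow> 'w family \<Rightarrow> bool" where
  "asymptotically_null M \<theta> \<Phi> K \<longleftrightarrow>
     (AE \<tau> in lborel. \<forall>\<omega>\<in>space M. \<forall>\<epsilon>>0. \<exists>T>0. \<exists>I\<^sub>0. tail_bound \<theta> \<Phi> K \<epsilon> \<tau> \<omega> T I\<^sub>0)"

section \<open>Kolmogorov entropy\<close>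

definition ball_cover :: "real \<Rightarrow> 'a::banach set \<Rightarrow> nat \<Rightarrow> bool" where
  "ball_cover \<epsilon> Y n \<longleftrightarrow> n \<ge> 1 \<and> (\<exists>c :: nat \<Rightarrow> 'a. Y \<subseteq> (\<Union>k<n. ball (c k) \<epsilon>))"

definition kolmogorov_entropy :: "real \<Rightarrow> 'a::banach set \<Rightarrow> ereal" where
  "kolmogorov_entropy \<epsilon> Y =
     (if \<exists>n. ball_cover \<epsilon> Y n then ereal (ln (real (LEAST n. ball_cover \<epsilon> Y n))) else \<infinity>)"

text \<open>
  The bound below, with \<open>r\<^sub>0 = set_norm (K \<tau> \<omega>)\<close>, does not hold for every index \<open>I\<^sub>0\<close> whose tails are at
  most \<open>\<epsilon>\<close>: a flow on a finite-dimensional coordinate subspace orthogonal to the zeroth basis vector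
  may have the closed ball of radius \<open>\<epsilon>\<close> as attractor; then \<open>I\<^sub>0 = 0\<close> is allowed, but the number
  of open \<open>\<epsilon>\<close>-balls needed grows with the dimension. It holds for a suitable such index, and for
  every index whose tails are at most \<open>\<epsilon> / 2\<close>.
\<close>

definition entropy_bound :: "nat \<Rightarrow> real \<Rightarrow> real \<Rightarrow> real" where
  "entropy_bound I\<^sub>0 r\<^sub>0 \<epsilon> =
     real (2 * I\<^sub>0 + 1) *
     ln (real_of_int \<lfloor>2 * r\<^sub>0 * sqrt (real (2 * I\<^sub>0 + 1)) / \<epsilon>\<rfloor> + 1)"

end

theory Submission
  imports Defs
begin

text \<open>
  By absorption every pullback image of a tempered family eventually lies in each single pullback
  image of \<open>K\<close>. At almost every \<open>\<tau>\<close> these images are bounded with uniformly small tails, so they are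
  asymptotically covered by finite grids in the head coordinates; this gives asymptotic compactness
  there, and the cocycle property transports it to every \<open>\<tau>\<close>. Hence the omega-limit set of \<open>K\<close> is
  the attractor. Because it is the Hausdorff limit of the images of \<open>K\<close> at integer times, its
  measurability reduces to that of a single image. The same grid bounds the entropy.
\<close>

section \<open>Tails and finite grids\<close>

text \<open>Two obstacles shape the proof: tails are controlled only for almost every
  \<open>\<tau>\<close>, and \<open>\<Phi> t \<tau> \<omega>\<close> is merely continuous, so the
  image of the bounded set \<open>K\<close> may be unbounded and need not be closed. Boundedness is
  therefore drawn from absorption into \<open>K\<close> itself, and tail control from inclusion into
  one image \<open>pull K S\<close>. That inclusion comes from splitting a pullback of length
  \<open>t\<close> into a stretch of length \<open>t - s\<close>, which ends inside \<open>K\<close>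
  over the earlier fibre, and a last stretch of length \<open>s\<close>. It is available for each
  \<open>s \<ge> 0\<close>, so the omega-limit set lies in the closure of every image of
  \<open>K\<close>, not only of the late ones; with attraction this squeezes \<open>infdist\<close>
  to the omega-limit set. In the entropy estimate the squared distance to a grid point splits into a
  head and a tail, each at most \<open>(\<epsilon> / 2)\<^sup>2\<close>. Hence tails are asked for
  at level \<open>\<epsilon> / 2\<close>, and the floor in \<open>entropy_bound\<close> counts
  exactly the grid points per coordinate that bring the head below
  \<open>\<epsilon> / 2\<close>.\<close>

definition tail_sq :: "nat \<Rightarrow> ell2 \<Rightarrow> real" where
  "tail_sq I u = (\<Sum>\<^sub>\<infinity>i\<in>{i. \<bar>i\<bar> > int I}. (coord u i)\<^sup>2)"

lemma norm_sq_split: "(norm u)\<^sup>2 = (\<Sum>i\<in>{- int I..int I}. (coord u i)\<^sup>2) + tail_sq I u"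
proof -
  have UNIV: "{- int I..int I} \<union> {i. \<bar>i\<bar> > int I} = UNIV"
    by auto
  have "(norm u)\<^sup>2 = infsum (\<lambda>i. (coord u i)\<^sup>2) ({- int I..int I} \<union> {i. \<bar>i\<bar> > int I})"
    unfolding norm_ell2_sq UNIV ..
  also have "\<dots> = infsum (\<lambda>i. (coord u i)\<^sup>2) {- int I..int I} + tail_sq I u"
    unfolding tail_sq_def by (rule infsum_Un_disjoint) (auto intro: coord_sq_summable)
  finally show ?thesis by simp
qed

lemma tail_sq_small:
  assumes "0 < e"
  obtains I where "tail_sq I u \<le> e"
proof -
  have "(sum (\<lambda>i. (coord u i)\<^sup>2) \<longlongrightarrow> (norm u)\<^sup>2) (finite_subsets_at_top UNIV)"
    unfolding norm_ell2_sq has_sum_def[symmetric] by (rule has_sum_infsum[OF coord_sq_summable])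
  then have "\<forall>\<^sub>F G in finite_subsets_at_top UNIV. dist (\<Sum>i\<in>G. (coord u i)\<^sup>2) ((norm u)\<^sup>2) < e"
    using assms by (rule tendstoD)
  then obtain F where F: "finite F"
    "\<forall>G. finite G \<and> F \<subseteq> G \<and> G \<subseteq> UNIV \<longrightarrow> dist (\<Sum>i\<in>G. (coord u i)\<^sup>2) ((norm u)\<^sup>2) < e"
    unfolding eventually_finite_subsets_at_top by meson
  \<comment> \<open>Any bound for \<open>\<bar>i\<bar>\<close> on \<open>F\<close> would do; the
    sum, unlike a maximum, also makes sense for empty \<open>F\<close>.\<close>
  define m where "m = (\<Sum>i\<in>F. \<bar>i\<bar>)"
  have m: "\<bar>i\<bar> \<le> m" if "i \<in> F" for i
    unfolding m_def using F(1) that by (intro member_le_sum[of i F abs]) auto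
  have "F \<subseteq> {- int (nat m)..int (nat m)}"
  proof
    fix i assume "i \<in> F"
    from m[OF this] show "i \<in> {- int (nat m)..int (nat m)}" by auto
  qed
  then have "dist (\<Sum>i\<in>{- int (nat m)..int (nat m)}. (coord u i)\<^sup>2) ((norm u)\<^sup>2) < e"
    using F(2) by blast
  then have "tail_sq (nat m) u \<le> e"
    using norm_sq_split[of u "nat m"] by (simp add: dist_real_def)
  then show thesis by (rule that)
qed

lemma ball_coverI:
  fixes c :: "'b \<Rightarrow> 'a::banach"
  assumes "finite P" "card P = n" "1 \<le> n" "Y \<subseteq> (\<Union>p\<in>P. ball (c p) \<epsilon>)"
  shows "ball_cover \<epsilon> Y n"
proof -
  obtain h where h: "bij_betw h {0..<n} P"
    using ex_bij_betw_nat_finite[OF assms(1)] assms(2) by blast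
  have "Y \<subseteq> (\<Union>k<n. ball ((c \<circ> h) k) \<epsilon>)"
    using assms(4) bij_betw_imp_surj_on[OF h] by (fastforce simp: lessThan_atLeast0)
  then show ?thesis
    unfolding ball_cover_def using assms(3) by blast
qed

text \<open>The points are the midpoints of the \<open>N\<close> cells of length
  \<open>2 * r / N\<close> that make up the interval from \<open>- r\<close> to \<open>r\<close>, so
  the error is half a cell.\<close>

lemma grid_point:
  fixes x r :: real
  assumes "\<bar>x\<bar> \<le> r" "1 \<le> N"
  shows "\<exists>k<N. \<bar>x - ((2 * real k + 1) * r / real N - r)\<bar> \<le> r / real N"
proof (cases "x = r \<or> r = 0")
  case True
  then show ?thesis
  proof
    assume "r = 0"
    then show ?thesis using assms by (intro exI[of _ 0]) auto
  next
    assume "x = r"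
    then show ?thesis using assms
      by (intro exI[of _ "N - 1"]) (auto simp: of_nat_diff field_simps)
  qed
next
  case False
  \<comment> \<open>\<open>y\<close> is the position of \<open>x\<close> counted in cells from
    \<open>- r\<close>, and its floor is the index of a half-open cell. This is why
    \<open>x = r\<close>, which lies in no such cell, and \<open>r = 0\<close>, where cells have no
    length, were set apart.\<close>
  define y where "y = (x + r) * real N / (2 * r)"
  have r: "r > 0" and x: "x < r" "- r \<le> x" using False assms by auto
  have y: "0 \<le> y" "y < real N" using r x assms(2)
    by (auto simp: y_def divide_less_eq)
  have xy: "x = 2 * r * y / real N - r" using r assms(2) by (simp add: y_def field_simps)
  define k where "k = nat \<lfloor>y\<rfloor>"
  have k: "real k \<le> y" "y < real k + 1"
    using y unfolding k_def by (auto simp: of_nat_nat)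
  have "k < N" using k y by linarith
  moreover have "x - ((2 * real k + 1) * r / real N - r) = (2 * (y - real k) - 1) * (r / real N)"
    using assms(2) by (simp add: xy field_simps)
  moreover have "\<bar>(2 * (y - real k) - 1) * (r / real N)\<bar> \<le> 1 * (r / real N)"
    using k r by (subst abs_mult, intro mult_mono) auto
  ultimately show ?thesis by auto
qed

text \<open>A grid point is off by at most \<open>r / N\<close> in each of the
  \<open>2 * I + 1\<close> head coordinates. \<open>N\<close> exceeds
  \<open>2 * r * sqrt (2 * I + 1) / \<epsilon>\<close> strictly, so the head error is below
  \<open>\<epsilon> / 2\<close>; with the tail, the squared distance stays below
  \<open>\<epsilon>\<^sup>2 / 2\<close>.\<close>

lemma ball_cover_grid:
  fixes Y :: "ell2 set" and r \<epsilon> :: real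
  assumes \<epsilon>: "0 < \<epsilon>" and r: "0 \<le> r"
    and norm: "\<And>u. u \<in> Y \<Longrightarrow> norm u \<le> r"
    and tail: "\<And>u. u \<in> Y \<Longrightarrow> tail_sq I u \<le> (\<epsilon> / 2)\<^sup>2"
    and N: "N = nat \<lfloor>2 * r * sqrt (real (2 * I + 1)) / \<epsilon>\<rfloor> + 1"
  shows "ball_cover \<epsilon> Y (N ^ (2 * I + 1))"
proof -
  define J where "J = {- int I..int I}"
  define g where "g = (\<lambda>k::nat. (2 * real k + 1) * r / real N - r)"
  define c where "c = (\<lambda>p. Abs_ell2 (\<lambda>i. if i \<in> J then g (p i) else 0))"
  have [simp]: "finite J" "card J = 2 * I + 1" by (auto simp: J_def)
  have c: "coord (c p) i = (if i \<in> J then g (p i) else 0)" for p i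
    unfolding c_def
    by (subst coord_Abs_ell2, rule finite_nonzero_values_imp_summable_on)
      (auto intro: finite_subset[of _ J])
  have N1: "1 \<le> N" by (simp add: N)
  have mesh: "real (2 * I + 1) * (r / real N)\<^sup>2 < (\<epsilon> / 2)\<^sup>2"
  proof -
    have "2 * r * sqrt (real (2 * I + 1)) / \<epsilon> < real N"
      using r \<epsilon> unfolding N by (simp add: of_nat_nat) linarith
    then have "sqrt (real (2 * I + 1)) * (r / real N) < \<epsilon> / 2"
      using \<epsilon> N1 by (simp add: field_simps)
    then have "(sqrt (real (2 * I + 1)) * (r / real N))\<^sup>2 < (\<epsilon> / 2)\<^sup>2"
      using r by (intro power_strict_mono) auto
    then show ?thesis by (simp only: power_mult_distrib real_sqrt_pow2 of_nat_0_le_iff)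
  qed
  have "Y \<subseteq> (\<Union>p\<in>PiE J (\<lambda>_. {..<N}). ball (c p) \<epsilon>)"
  proof
    fix u assume u: "u \<in> Y"
    have "\<exists>k<N. \<bar>coord u i - g k\<bar> \<le> r / real N" for i
      unfolding g_def by (rule grid_point) (use abs_coord_le[of u i] norm[OF u] N1 in auto)
    then obtain q where q: "\<And>i. q i < N" "\<And>i. \<bar>coord u i - g (q i)\<bar> \<le> r / real N"
      by metis
    \<comment> \<open>Restricting to \<open>J\<close> puts the choice into the extensional function
      space \<open>PiE\<close>, which is finite and has exactly \<open>N ^ (2 * I + 1)\<close>
      elements.\<close>
    define p where "p = restrict q J"
    have "(\<Sum>i\<in>J. (coord (u - c p) i)\<^sup>2) \<le> (\<Sum>i\<in>J. (r / real N)\<^sup>2)"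
    proof (rule sum_mono)
      fix i assume "i \<in> J"
      then have "\<bar>coord (u - c p) i\<bar> \<le> r / real N"
        using q(2)[of i] by (simp add: c p_def)
      then show "(coord (u - c p) i)\<^sup>2 \<le> (r / real N)\<^sup>2"
        by (metis abs_ge_zero power2_abs power_mono)
    qed
    moreover have "tail_sq I (u - c p) = tail_sq I u"
      unfolding tail_sq_def by (rule infsum_cong) (auto simp: c J_def)
    ultimately have "(norm (u - c p))\<^sup>2 < (\<epsilon> / 2)\<^sup>2 + (\<epsilon> / 2)\<^sup>2"
      using mesh tail[OF u] norm_sq_split[of "u - c p" I]
      unfolding J_def[symmetric] by simp
    also have "\<dots> \<le> \<epsilon>\<^sup>2" by (simp add: power2_eq_square)
    finally have "norm (u - c p) < \<epsilon>"
      using \<epsilon> by (simp add: power_less_imp_less_base)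
    then have "u \<in> ball (c p) \<epsilon>" by (simp add: dist_norm norm_minus_commute)
    moreover have "p \<in> PiE J (\<lambda>_. {..<N})" using q(1) by (auto simp: p_def)
    ultimately show "u \<in> (\<Union>p\<in>PiE J (\<lambda>_. {..<N}). ball (c p) \<epsilon>)" by blast
  qed
  moreover have "card (PiE J (\<lambda>_. {..<N})) = N ^ (2 * I + 1)"
    by (simp add: card_PiE)
  ultimately show ?thesis
    using N1 by (intro ball_coverI[where c = c]) (auto intro: finite_PiE)
qed

lemma kolmogorov_entropy_le:
  fixes Y :: "ell2 set" and r \<epsilon> :: real
  assumes "0 < \<epsilon>" "0 \<le> r"
    and "\<And>u. u \<in> Y \<Longrightarrow> norm u \<le> r"
    and "\<And>u. u \<in> Y \<Longrightarrow> tail_sq I u \<le> (\<epsilon> / 2)\<^sup>2"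
  shows "kolmogorov_entropy \<epsilon> Y \<le> ereal (entropy_bound I r \<epsilon>)"
proof -
  define N where "N = nat \<lfloor>2 * r * sqrt (real (2 * I + 1)) / \<epsilon>\<rfloor> + 1"
  have cover: "ball_cover \<epsilon> Y (N ^ (2 * I + 1))"
    by (rule ball_cover_grid[OF assms(1,2) _ _ N_def]) (use assms in auto)
  define n where "n = (LEAST n. ball_cover \<epsilon> Y n)"
  have "ball_cover \<epsilon> Y n" unfolding n_def by (rule LeastI) (rule cover)
  then have "1 \<le> n" by (simp add: ball_cover_def)
  moreover have "n \<le> N ^ (2 * I + 1)" unfolding n_def by (rule Least_le) (rule cover)
  ultimately have "ln (real n) \<le> ln (real (N ^ (2 * I + 1)))"
    by (intro ln_mono of_nat_mono) simp_all
  also have "\<dots> = real (2 * I + 1) * ln (real N)"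
    unfolding of_nat_power by (rule ln_realpow)
  also have "\<dots> = entropy_bound I r \<epsilon>"
    using assms(1,2) by (simp add: entropy_bound_def N_def of_nat_nat add.commute)
  finally show ?thesis
    using cover unfolding kolmogorov_entropy_def n_def by auto
qed

text \<open>A bound on the norm and a small tail place every vector, for each accuracy, in one of
  the countably many sets \<open>Y r I k\<close>; a grid covers each of these by finitely many
  balls, and the centres together are dense. The dense set later makes infima over random sets
  measurable.\<close>

lemma ell2_separable: "\<exists>D :: ell2 set. countable D \<and> closure D = UNIV"
proof -
  define Y :: "nat \<Rightarrow> nat \<Rightarrow> nat \<Rightarrow> ell2 set" where
    "Y = (\<lambda>r I k. {u. norm u \<le> real r \<and> tail_sq I u \<le> (1 / real (Suc k) / 2)\<^sup>2})"
  have "\<exists>C. countable C \<and> Y r I k \<subseteq> (\<Union>c\<in>C. ball c (1 / real (Suc k)))" for r I k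
  proof -
    have "ball_cover (1 / real (Suc k)) (Y r I k)
      ((nat \<lfloor>2 * real r * sqrt (real (2 * I + 1)) / (1 / real (Suc k))\<rfloor> + 1) ^ (2 * I + 1))"
      by (rule ball_cover_grid[OF _ _ _ _ refl]) (simp_all add: Y_def)
    then obtain n :: nat and c where "Y r I k \<subseteq> (\<Union>j<n. ball (c j) (1 / real (Suc k)))"
      unfolding ball_cover_def by blast
    then show ?thesis by (intro exI[of _ "c ` {..<n}"]) auto
  qed
  then obtain C where C: "\<And>r I k. countable (C r I k)"
    "\<And>r I k. Y r I k \<subseteq> (\<Union>c\<in>C r I k. ball c (1 / real (Suc k)))"
    by metis
  define D where "D = (\<Union>r I k. C r I k)"
  have "u \<in> closure D" for u
    unfolding closure_approachable
  proof (intro allI impI)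
    fix e :: real assume "0 < e"
    then obtain k where k: "1 / real (Suc k) < e" using nat_approx_posE by blast
    obtain I where "tail_sq I u \<le> (1 / real (Suc k) / 2)\<^sup>2"
      by (rule tail_sq_small) auto
    moreover obtain r where "norm u \<le> real r" using real_arch_simple by blast
    ultimately have "u \<in> Y r I k" by (simp add: Y_def)
    then obtain c where "c \<in> C r I k" "dist c u < 1 / real (Suc k)"
      using C(2)[of r I k] by auto
    then show "\<exists>y\<in>D. dist y u < e" using k unfolding D_def by force
  qed
  moreover have "countable D" unfolding D_def using C(1) by auto
  ultimately show ?thesis by blast
qed

text \<open>The range is totally bounded, since grids cover all late terms at every accuracy;
  completeness makes its closure compact.\<close>

lemma convergent_subseq_of_small_tails:
  fixes X :: "nat \<Rightarrow> ell2"
  assumes bounded: "\<forall>\<^sub>F n in sequentially. norm (X n) \<le> r"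
    and tails: "\<And>\<epsilon>. 0 < \<epsilon> \<Longrightarrow> \<exists>I. \<forall>\<^sub>F n in sequentially. tail_sq I (X n) \<le> \<epsilon>\<^sup>2"
  obtains l \<rho> where "strict_mono \<rho>" "(X \<circ> \<rho>) \<longlonglongrightarrow> l"
proof -
  have r: "0 \<le> max r 0" by simp
  have net: "\<exists>C. finite C \<and> range X \<subseteq> (\<Union>c\<in>C. ball c e)" if "0 < e" for e
  proof -
    from that tails[of "e / 2"] obtain I where
      "\<forall>\<^sub>F n in sequentially. tail_sq I (X n) \<le> (e / 2)\<^sup>2" by auto
    with bounded have "\<forall>\<^sub>F n in sequentially. norm (X n) \<le> r \<and> tail_sq I (X n) \<le> (e / 2)\<^sup>2"
      by (rule eventually_conj)
    then obtain m where
      m: "\<And>n. n \<ge> m \<Longrightarrow> norm (X n) \<le> r \<and> tail_sq I (X n) \<le> (e / 2)\<^sup>2"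
      by (auto simp: eventually_sequentially)
    have "\<exists>N. ball_cover e (X ` {m..}) N"
      by (rule exI, rule ball_cover_grid[OF that r _ _ refl]) (use m max.coboundedI1 in auto)
    then obtain c and N :: nat where "X ` {m..} \<subseteq> (\<Union>k<N. ball (c k) e)"
      unfolding ball_cover_def by blast
    \<comment> \<open>Nothing is assumed about the first \<open>m\<close> terms; they serve as their
      own centres.\<close>
    moreover have "X ` {..<m} \<subseteq> (\<Union>x\<in>X ` {..<m}. ball x e)"
      using that by auto
    moreover have "range X = X ` {..<m} \<union> X ` {m..}"
    proof -
      have "{..<m} \<union> {m..} = UNIV" by auto
      then show ?thesis by (simp only: image_Un[symmetric])
    qed
    ultimately have "range X \<subseteq> (\<Union>x\<in>c ` {..<N} \<union> X ` {..<m}. ball x e)"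
      by auto
    then show ?thesis by (intro exI[of _ "c ` {..<N} \<union> X ` {..<m}"]) auto
  qed
  have "compact (closure (range X))"
    unfolding compact_eq_totally_bounded
  proof (intro conjI allI impI)
    show "uniform_space_class.complete (closure (range X))" by (simp add: complete_eq_closed)
    fix e :: real assume e: "0 < e"
    then obtain C where C: "finite C" "range X \<subseteq> (\<Union>c\<in>C. ball c (e / 2))"
      using net[of "e / 2"] by auto
    \<comment> \<open>A finite union of closed balls is closed and so contains the closure; starting
      from radius \<open>e / 2\<close> leaves room to return to open balls.\<close>
    have "closure (range X) \<subseteq> (\<Union>c\<in>C. cball c (e / 2))"
    proof (rule closure_minimal)
      show "range X \<subseteq> (\<Union>c\<in>C. cball c (e / 2))"
        using C(2) ball_subset_cball by blast
    qed (use C(1) in auto)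
    also have "\<dots> \<subseteq> (\<Union>c\<in>C. ball c e)" using e by (intro UN_mono) auto
    finally show "\<exists>k. finite k \<and> closure (range X) \<subseteq> (\<Union>x\<in>k. ball x e)" using C(1) by blast
  qed
  moreover have "X n \<in> closure (range X)" for n by (simp add: closure_subset[THEN subsetD])
  ultimately have "\<exists>l\<in>closure (range X). \<exists>\<rho>. strict_mono \<rho> \<and> (X \<circ> \<rho>) \<longlonglongrightarrow> l"
    unfolding compact_def by meson
  then show thesis using that by blast
qed

section \<open>Hausdorff semidistance and measurability\<close>

lemma hausdorff_semidist_less:
  assumes "hausdorff_semidist Y Z < ennreal e" "y \<in> Y"
  obtains z where "z \<in> Z" "dist y z < e"
proof -
  have "(INF z\<in>Z. ennreal (norm (y - z))) < ennreal e"
    using assms(1) unfolding hausdorff_semidist_def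
    by (rule le_less_trans[rotated]) (rule SUP_upper[OF assms(2)])
  then obtain z where "z \<in> Z" "ennreal (norm (y - z)) < ennreal e"
    unfolding INF_less_iff by blast
  then show thesis using that by (simp add: dist_norm ennreal_less_iff)
qed

lemma hausdorff_semidist_le:
  assumes "\<And>y. y \<in> Y \<Longrightarrow> \<exists>z\<in>Z. dist y z < e"
  shows "hausdorff_semidist Y Z \<le> ennreal e"
  unfolding hausdorff_semidist_def
proof (rule SUP_least)
  fix y assume "y \<in> Y"
  then obtain z where "z \<in> Z" "dist y z < e" using assms by blast
  then show "(INF z\<in>Z. ennreal (norm (y - z))) \<le> ennreal e"
    by (intro INF_lower2[of z]) (auto simp: dist_norm intro!: ennreal_leI)
qed

lemma tendsto_zero_ennrealI:
  fixes f :: "'a \<Rightarrow> ennreal"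
  assumes "\<And>e. 0 < e \<Longrightarrow> \<forall>\<^sub>F x in F. f x \<le> ennreal e"
  shows "(f \<longlongrightarrow> 0) F"
proof (rule order_tendstoI)
  fix a :: ennreal assume "0 < a"
  then obtain b where b: "0 < b" "b < a" using dense by blast
  then have "b = ennreal (enn2real b)"
    using less_le_trans[OF b(2) top_greatest] by simp
  moreover have "0 < enn2real b"
    using b(1) less_le_trans[OF b(2) top_greatest] by (simp add: enn2real_positive_iff)
  moreover note b(2)
  ultimately have "0 < enn2real b" "ennreal (enn2real b) < a" by simp_all
  with assms[of "enn2real b"] show "\<forall>\<^sub>F x in F. f x < a"
    by (auto elim: eventually_mono)
qed simp

text \<open>The assumptions act on opposite sides: \<open>below\<close> gives
  \<open>infdist x (P k) \<le> infdist x A\<close> for every \<open>k\<close>, and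
  \<open>semi\<close> gives the reverse inequality up to \<open>e / 2\<close> eventually.\<close>

lemma tendsto_infdist_of_semidist:
  assumes "A \<noteq> {}"
    and below: "\<And>k. A \<subseteq> closure (P k)"
    and semi: "((\<lambda>k. hausdorff_semidist (P k) A) \<longlongrightarrow> 0) F"
  shows "((\<lambda>k. infdist x (P k)) \<longlongrightarrow> infdist x A) F"
proof (rule tendstoI)
  fix e :: real assume e: "0 < e"
  have ne: "P k \<noteq> {}" for k using assms(1) below[of k] by auto
  have "\<forall>\<^sub>F k in F. hausdorff_semidist (P k) A < ennreal (e / 2)"
    using semi by (rule order_tendstoD) (use e in simp)
  then show "\<forall>\<^sub>F k in F. dist (infdist x (P k)) (infdist x A) < e"
  proof eventually_elim
    case (elim k)
    have "infdist x (P k) \<le> infdist x A"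
      unfolding infdist_notempty[OF assms(1)]
    proof (rule cINF_greatest[OF assms(1)])
      fix a assume "a \<in> A"
      then have "infdist a (P k) = 0"
        using below[of k] in_closure_iff_infdist_zero[OF ne[of k]] by auto
      then show "infdist x (P k) \<le> dist x a"
        using infdist_triangle[of x "P k" a] by simp
    qed
    moreover have "infdist x A - e / 2 \<le> infdist x (P k)"
      unfolding infdist_notempty[OF ne[of k]]
    proof (rule cINF_greatest[OF ne])
      fix y assume "y \<in> P k"
      then obtain z where "z \<in> A" "dist y z < e / 2"
        using hausdorff_semidist_less[OF elim] by blast
      then show "infdist x A - e / 2 \<le> dist x y"
        using infdist_le[of z A x] dist_triangle[of x z y] by linarith
    qed
    ultimately show ?case using e by (simp add: dist_real_def)
  qed
qed

text \<open>
  A strict sublevel set of the infimum is a countable union over the balls of a countable base: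
  \<open>K \<omega>\<close> meets the ball and \<open>f \<omega> \<le> q\<close> holds on it. This makes a measurable selection superfluous.
\<close>

lemma borel_measurable_INF_random_set:
  fixes f :: "'w \<Rightarrow> 'a::metric_space \<Rightarrow> real" and D :: "'a set"
  assumes D: "countable D" "closure D = UNIV"
    and f: "\<And>d. (\<lambda>\<omega>. f \<omega> d) \<in> borel_measurable M"
    and cont: "\<And>\<omega>. \<omega> \<in> space M \<Longrightarrow> continuous_on UNIV (f \<omega>)"
    and nonneg: "\<And>\<omega> u. 0 \<le> f \<omega> u"
    and K: "\<And>d. (\<lambda>\<omega>. infdist d (K \<omega>)) \<in> borel_measurable M"
    and ne: "\<And>\<omega>. \<omega> \<in> space M \<Longrightarrow> K \<omega> \<noteq> {}"
  shows "(\<lambda>\<omega>. INF u\<in>K \<omega>. f \<omega> u) \<in> borel_measurable M"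
proof (rule borel_measurable_iff_less[THEN iffD2], rule allI)
  fix c
  \<comment> \<open>The upper bound is tested on the countable set \<open>D\<close> only, which
    keeps \<open>S q d r\<close> measurable. Passing to limits preserves just
    \<open>\<le> q\<close>, so the strict inequality with \<open>c\<close> has to come from
    \<open>q < c\<close>.\<close>
  define S where "S = (\<lambda>q d r. {\<omega>\<in>space M. infdist d (K \<omega>) < r} \<inter>
    {\<omega>\<in>space M. \<forall>d'\<in>D. d' \<in> ball d r \<longrightarrow> f \<omega> d' \<le> q})"
  have "{\<omega>\<in>space M. (INF u\<in>K \<omega>. f \<omega> u) < c} =
      (\<Union>q\<in>\<rat> \<inter> {..<c}. \<Union>d\<in>D. \<Union>r\<in>\<rat>. S q d r)" (is "?L = ?R")
  proof (intro equalityI subsetI)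
    fix \<omega> assume "\<omega> \<in> ?L"
    then have \<omega>: "\<omega> \<in> space M" and "(INF u\<in>K \<omega>. f \<omega> u) < c" by auto
    then obtain u where u: "u \<in> K \<omega>" "f \<omega> u < c"
      using cInf_lessD[of "f \<omega> ` K \<omega>" c] ne by auto
    then obtain q where q: "q \<in> \<rat>" "f \<omega> u < q" "q < c"
      using Rats_dense_in_real by blast
    have "open {v. f \<omega> v < q}"
      using open_Collect_less[OF cont[OF \<omega>] continuous_on_const] .
    then obtain \<delta> where \<delta>: "0 < \<delta>" "ball u \<delta> \<subseteq> {v. f \<omega> v < q}"
      using q(2) by (auto simp: open_contains_ball)
    have "u \<in> closure D" using D(2) by simp
    then obtain d where d: "d \<in> D" "dist d u < \<delta> / 2"
      unfolding closure_approachable using \<delta>(1) by (meson half_gt_zero)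
    then obtain r where r: "r \<in> \<rat>" "dist d u < r" "r < \<delta> / 2"
      using Rats_dense_in_real by blast
    have "f \<omega> d' \<le> q" if "dist d d' < r" for d'
    proof -
      have "dist u d' \<le> dist d u + dist d d'" by (metis dist_commute dist_triangle)
      then have "d' \<in> ball u \<delta>" using that r d by simp
      then show ?thesis using \<delta>(2) by auto
    qed
    moreover have "infdist d (K \<omega>) < r"
      using infdist_le[OF u(1), of d] r by linarith
    ultimately have "\<omega> \<in> S q d r" using \<omega> by (simp add: S_def)
    then show "\<omega> \<in> ?R" using q d(1) r(1) by blast
  next
    fix \<omega> assume "\<omega> \<in> ?R"
    then obtain q d r where q: "q < c" and S: "\<omega> \<in> S q d r" by blast
    then have \<omega>: "\<omega> \<in> space M" and dr: "infdist d (K \<omega>) < r"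
      and fq: "\<And>d'. d' \<in> D \<Longrightarrow> d' \<in> ball d r \<Longrightarrow> f \<omega> d' \<le> q"
      by (auto simp: S_def)
    obtain u where u: "u \<in> K \<omega>" "dist d u < r"
      using dr cInf_lessD[of "dist d ` K \<omega>" r] ne[OF \<omega>] by (auto simp: infdist_notempty)
    \<comment> \<open>The ball is open, so points of \<open>D\<close> inside it accumulate at
      \<open>u\<close>, and continuity extends the bound from them to \<open>u\<close>.\<close>
    have "u \<in> closure (ball d r \<inter> D)"
      using open_Int_closure_subset[of "ball d r" D] D(2) u(2) by auto
    then have "f \<omega> u \<le> q"
      by (rule continuous_le_on_closure[rotated])
        (use fq cont[OF \<omega>] in \<open>auto intro: continuous_on_subset\<close>)
    moreover have "(INF u\<in>K \<omega>. f \<omega> u) \<le> f \<omega> u"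
      using u(1) nonneg by (intro cINF_lower bdd_belowI2[of _ 0])
    ultimately show "\<omega> \<in> ?L" using \<omega> q by auto
  qed
  moreover have S: "S q d r \<in> sets M" for q d r
  proof -
    have "{\<omega>\<in>space M. \<forall>d'\<in>D. d' \<in> ball d r \<longrightarrow> f \<omega> d' \<le> q} \<in> sets M"
    proof -
      have "{\<omega>\<in>space M. d' \<in> ball d r \<and> q < f \<omega> d'} \<in> sets M" for d'
        using f[of d'] by (cases "d' \<in> ball d r") auto
      then have "space M - (\<Union>d'\<in>D. {\<omega>\<in>space M. d' \<in> ball d r \<and> q < f \<omega> d'}) \<in> sets M"
        by (intro sets.compl_sets sets.countable_UN''[OF D(1)])
      also have "space M - (\<Union>d'\<in>D. {\<omega>\<in>space M. d' \<in> ball d r \<and> q < f \<omega> d'})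
          = {\<omega>\<in>space M. \<forall>d'\<in>D. d' \<in> ball d r \<longrightarrow> f \<omega> d' \<le> q}"
        by (auto simp: not_less)
      finally show ?thesis .
    qed
    moreover have "{\<omega>\<in>space M. infdist d (K \<omega>) < r} \<in> sets M"
      using K[of d] by simp
    ultimately show ?thesis unfolding S_def by auto
  qed
  moreover have "?R \<in> sets M"
    by (intro sets.countable_UN'' countable_Int1 countable_rat D(1) S)
  ultimately show "?L \<in> sets M" by (simp only:)
qed

text \<open>A set of the completion differs from a measurable one by part of a null set
  \<open>Z'\<close>, and preservation of the measure keeps the preimage of \<open>Z'\<close> null.
  Applied to the shifts, since \<open>K\<close> is measurable only for the completion.\<close>

lemma measurable_completion_of_measure_preserving:
  assumes g: "g \<in> M \<rightarrow>\<^sub>M N" and pres: "distr M N g = N"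
  shows "g \<in> completion M \<rightarrow>\<^sub>M completion N"
proof (rule measurableI)
  show "g x \<in> space (completion N)" if "x \<in> space (completion M)" for x
    using measurable_space[OF g] that by simp
  fix A assume "A \<in> sets (completion N)"
  then obtain S Z Z' where A: "A = S \<union> Z" "Z \<subseteq> Z'" "Z' \<in> null_sets N" "S \<in> sets N"
    by (rule sets_completionE)
  have "emeasure M (g -` Z' \<inter> space M) = emeasure (distr M N g) Z'"
    using A(3) g by (simp add: emeasure_distr null_setsD2)
  also have "\<dots> = 0" using A(3) by (simp add: pres null_setsD1)
  finally have "g -` Z' \<inter> space M \<in> null_sets M"
    using A(3) measurable_sets[OF g] by (auto simp: null_sets_def)
  then show "g -` A \<inter> space (completion M) \<in> sets (completion M)"
    by (intro sets_completionI[of _ "g -` S \<inter> space M" "g -` Z \<inter> space M" "g -` Z' \<inter> space M"])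
      (use A measurable_sets[OF g] in auto)
qed

text \<open>A null set cannot contain an interval of positive length. This supplies a time with
  small tails shortly before any given \<open>\<tau>\<close>.\<close>

lemma AE_lborel_dense:
  assumes "AE x in lborel. Q x" "(a::real) < b"
  obtains x where "a < x" "x < b" "Q x"
proof -
  obtain N where N: "{x \<in> space lborel. \<not> Q x} \<subseteq> N" "N \<in> null_sets lborel"
    using assms(1) unfolding eventually_ae_filter by blast
  have "\<not> {a<..<b} \<subseteq> N"
  proof
    assume "{a<..<b} \<subseteq> N"
    then have "emeasure lborel {a<..<b} \<le> emeasure lborel N"
      using N(2) by (intro emeasure_mono) auto
    then show False using N(2) assms(2) by (simp add: null_sets_def)
  qed
  then obtain x where "x \<in> {a<..<b}" "x \<notin> N" by blast
  moreover from this have "Q x" using N(1) by auto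
  ultimately show thesis using that by auto
qed

lemma set_norm_mono: "A \<subseteq> K \<Longrightarrow> A \<noteq> {} \<Longrightarrow> bounded K \<Longrightarrow> set_norm A \<le> set_norm K"
  unfolding set_norm_def by (rule cSUP_subset_mono) (auto simp: bounded_iff intro: bdd_aboveI2)

lemma norm_le_set_norm: "u \<in> K \<Longrightarrow> bounded K \<Longrightarrow> norm u \<le> set_norm K"
  unfolding set_norm_def by (rule cSUP_upper) (auto simp: bounded_iff intro: bdd_aboveI2)

text \<open>Points of the omega-limit set lie only in closures of images; this replaces them by
  genuine image points with vanishing error, to which the cocycle property applies.\<close>

lemma closure_sequence_near:
  assumes "\<And>n::nat. x n \<in> closure (S n)"
  obtains X where "\<And>n. X n \<in> S n" "(\<lambda>n. dist (X n) (x n)) \<longlonglongrightarrow> 0"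
proof -
  have "\<exists>y\<in>S n. dist y (x n) < inverse (real (Suc n))" for n
    using assms[of n] unfolding closure_approachable by simp
  then obtain X where X: "\<And>n. X n \<in> S n" "\<And>n. dist (X n) (x n) < inverse (real (Suc n))"
    by metis
  have "(\<lambda>n. dist (X n) (x n)) \<longlonglongrightarrow> 0"
    by (rule tendsto_sandwich[OF _ _ tendsto_const LIMSEQ_inverse_real_of_nat])
      (auto intro!: always_eventually less_imp_le X(2) simp del: of_nat_Suc)
  with X(1) show thesis by (rule that)
qed

section \<open>Pullback images and omega-limit sets\<close>

lemma tail_boundD:
  assumes "tail_bound \<theta> \<Phi> K \<epsilon> \<tau> \<omega> S I" "S \<le> t" "x \<in> pullback_image \<theta> \<Phi> K t \<tau> \<omega>"
  shows "tail_sq I x \<le> \<epsilon>\<^sup>2"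
proof -
  obtain u where u: "u \<in> K (\<tau> - t) (\<theta> (- t) \<omega>)" "x = \<Phi> t (\<tau> - t) (\<theta> (- t) \<omega>) u"
    using assms(3) by (auto simp: pullback_image_def)
  have "ennreal (tail_sq I x) \<le> (SUP u\<in>K (\<tau> - t) (\<theta> (- t) \<omega>).
      ennreal (tail_sq I (\<Phi> t (\<tau> - t) (\<theta> (- t) \<omega>) u)))"
    unfolding u(2) by (rule SUP_upper[OF u(1)])
  also have "\<dots> \<le> ennreal (\<epsilon>\<^sup>2)"
    using assms(1,2) unfolding tail_bound_def tail_sq_def by simp
  finally have "ennreal (tail_sq I x) \<le> ennreal (\<epsilon>\<^sup>2)" .
  then show ?thesis by simp
qed

lemma tail_bound_mono:
  assumes "tail_bound \<theta> \<Phi> K \<epsilon> \<tau> \<omega> S I" "0 \<le> \<epsilon>" "\<epsilon> \<le> \<delta>"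
  shows "tail_bound \<theta> \<Phi> K \<delta> \<tau> \<omega> S I"
proof -
  have "ennreal (\<epsilon>\<^sup>2) \<le> ennreal (\<delta>\<^sup>2)"
    using assms(2,3) by (intro ennreal_leI power_mono)
  then show ?thesis using assms(1) unfolding tail_bound_def by (meson order_trans)
qed

definition omega_limit ::
  "(real \<Rightarrow> 'w \<Rightarrow> 'w) \<Rightarrow> (real \<Rightarrow> real \<Rightarrow> 'w \<Rightarrow> ell2 \<Rightarrow> ell2) \<Rightarrow> 'w family \<Rightarrow> 'w family" where
  "omega_limit \<theta> \<Phi> B \<tau> \<omega> = (\<Inter>s. closure (\<Union>t\<in>{s..}. pullback_image \<theta> \<Phi> B t \<tau> \<omega>))"

text \<open>A decreasing intersection may start anywhere. With \<open>a\<close> equal to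
  \<open>T K \<tau> \<omega>\<close> this is the formula of the theorem, at every
  \<open>\<tau>\<close>.\<close>

lemma omega_limit_from:
  "omega_limit \<theta> \<Phi> B \<tau> \<omega> = (\<Inter>s\<in>{a..}. closure (\<Union>t\<in>{s..}. pullback_image \<theta> \<Phi> B t \<tau> \<omega>))"
proof -
  have "closure (\<Union>t\<in>{max a s..}. pullback_image \<theta> \<Phi> B t \<tau> \<omega>)
      \<subseteq> closure (\<Union>t\<in>{s..}. pullback_image \<theta> \<Phi> B t \<tau> \<omega>)" for s
    by (intro closure_mono UN_mono) auto
  moreover have "max a s \<in> {a..}" for s by simp
  ultimately show ?thesis unfolding omega_limit_def by blast
qed

locale continuous_cocycle_system =
  fixes M :: "'w measure" and \<theta> :: "real \<Rightarrow> 'w \<Rightarrow> 'w"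
    and \<Phi> :: "real \<Rightarrow> real \<Rightarrow> 'w \<Rightarrow> ell2 \<Rightarrow> ell2"
  assumes pds: "parametric_dynamical_system M \<theta>"
    and cocycle: "continuous_cocycle M \<theta> \<Phi>"
begin

abbreviation "\<D> \<equiv> tempered_families M \<theta>"
abbreviation "pull \<equiv> pullback_image \<theta> \<Phi>"

lemma measurable_shift: "\<theta> t \<in> M \<rightarrow>\<^sub>M M"
proof -
  have "(\<lambda>(t, \<omega>). \<theta> t \<omega>) \<in> borel \<Otimes>\<^sub>M M \<rightarrow>\<^sub>M M"
    using pds by (simp add: parametric_dynamical_system_def)
  from measurable_compose[OF measurable_Pair1' this, of t] show ?thesis by simp
qed

lemma shift_space [simp]: "\<omega> \<in> space M \<Longrightarrow> \<theta> t \<omega> \<in> space M"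
  by (rule measurable_space[OF measurable_shift])

lemma shift_shift [simp]: "\<omega> \<in> space M \<Longrightarrow> \<theta> s (\<theta> t \<omega>) = \<theta> (s + t) \<omega>"
  using pds by (simp add: parametric_dynamical_system_def)

lemma shift_zero [simp]: "\<omega> \<in> space M \<Longrightarrow> \<theta> 0 \<omega> = \<omega>"
  using pds by (simp add: parametric_dynamical_system_def)

lemma cocycle_add:
  "\<omega> \<in> space M \<Longrightarrow> 0 \<le> t \<Longrightarrow> 0 \<le> s \<Longrightarrow> \<Phi> (t + s) \<tau> \<omega> u = \<Phi> t (\<tau> + s) (\<theta> s \<omega>) (\<Phi> s \<tau> \<omega> u)"
  using cocycle by (simp add: continuous_cocycle_def)

lemma cocycle_continuous: "\<omega> \<in> space M \<Longrightarrow> 0 \<le> t \<Longrightarrow> continuous_on UNIV (\<Phi> t \<tau> \<omega>)"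
  using cocycle by (simp add: continuous_cocycle_def)

lemma cocycle_tendsto:
  assumes "\<omega> \<in> space M" "0 \<le> t" "(X \<longlongrightarrow> l) F"
  shows "((\<lambda>n. \<Phi> t \<tau> \<omega> (X n)) \<longlongrightarrow> \<Phi> t \<tau> \<omega> l) F"
  using continuous_on_tendsto_compose[OF cocycle_continuous[OF assms(1,2)] assms(3)] by simp

text \<open>The cocycle property seen from the endpoint: a pullback of length \<open>t\<close> first
  runs for \<open>t - s\<close> up to the fibre at \<open>\<tau> - s\<close>, then for
  \<open>s\<close>.\<close>

lemma pull_split:
  assumes "\<omega> \<in> space M" "0 \<le> s" "s \<le> t"
  shows "pull B t \<tau> \<omega> = \<Phi> s (\<tau> - s) (\<theta> (- s) \<omega>) ` pull B (t - s) (\<tau> - s) (\<theta> (- s) \<omega>)"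
proof -
  have "\<Phi> t (\<tau> - t) (\<theta> (- t) \<omega>) u
      = \<Phi> s (\<tau> - s) (\<theta> (- s) \<omega>) (\<Phi> (t - s) (\<tau> - t) (\<theta> (- t) \<omega>) u)" for u
    using cocycle_add[of "\<theta> (- t) \<omega>" s "t - s" "\<tau> - t" u] assms by simp
  then show ?thesis
    using assms(1) by (simp add: pullback_image_def image_image)
qed

lemma pull_forward:
  assumes "\<omega> \<in> space M" "0 \<le> s" "0 \<le> t"
  shows "pull B (t + s) (\<tau> + s) (\<theta> s \<omega>) = \<Phi> s \<tau> \<omega> ` pull B t \<tau> \<omega>"
  using pull_split[of "\<theta> s \<omega>" s "t + s" B "\<tau> + s"] assms by simp

lemma pull_attractor:
  assumes "pullback_attractor M \<theta> \<Phi> A" "\<omega> \<in> space M" "0 \<le> t"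
  shows "pull A t \<tau> \<omega> = A \<tau> \<omega>"
proof -
  have "\<Phi> t (\<tau> - t) (\<theta> (- t) \<omega>) ` A (\<tau> - t) (\<theta> (- t) \<omega>) = A (\<tau> - t + t) (\<theta> t (\<theta> (- t) \<omega>))"
    using assms shift_space[OF assms(2)] unfolding pullback_attractor_def by blast
  then show ?thesis using assms(2) by (simp add: pullback_image_def)
qed

text \<open>\<open>A'\<close> is itself tempered, hence attracted by \<open>A\<close>; invariance
  makes its pullback images constant, so the semidistance is already 0, and closedness of
  \<open>A\<close> concludes.\<close>

lemma pullback_attractor_subset:
  assumes A: "pullback_attractor M \<theta> \<Phi> A" and A': "pullback_attractor M \<theta> \<Phi> A'"
    and \<omega>: "\<omega> \<in> space M"
  shows "A' \<tau> \<omega> \<subseteq> A \<tau> \<omega>"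
proof
  fix y assume y: "y \<in> A' \<tau> \<omega>"
  have "A' \<in> \<D>" using A' by (simp add: pullback_attractor_def)
  then have "((\<lambda>t. hausdorff_semidist (pull A' t \<tau> \<omega>) (A \<tau> \<omega>)) \<longlongrightarrow> 0) at_top"
    using A \<omega> unfolding pullback_attractor_def by blast
  moreover have "\<forall>\<^sub>F t in at_top. hausdorff_semidist (pull A' t \<tau> \<omega>) (A \<tau> \<omega>)
      = hausdorff_semidist (A' \<tau> \<omega>) (A \<tau> \<omega>)"
    using eventually_ge_at_top[of "0::real"] by eventually_elim (simp add: pull_attractor[OF A' \<omega>])
  ultimately have "((\<lambda>t::real. hausdorff_semidist (A' \<tau> \<omega>) (A \<tau> \<omega>)) \<longlongrightarrow> 0) at_top"
    by (simp only: tendsto_cong)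
  then have zero: "hausdorff_semidist (A' \<tau> \<omega>) (A \<tau> \<omega>) = 0"
    by (simp add: tendsto_const_iff)
  have "y \<in> closure (A \<tau> \<omega>)"
    unfolding closure_approachable
  proof (intro allI impI)
    fix e :: real assume "0 < e"
    then have "hausdorff_semidist (A' \<tau> \<omega>) (A \<tau> \<omega>) < ennreal e" by (simp add: zero)
    from hausdorff_semidist_less[OF this y] show "\<exists>z\<in>A \<tau> \<omega>. dist z y < e"
      by (metis dist_commute)
  qed
  moreover have "closed (A \<tau> \<omega>)"
    using A \<omega> by (simp add: pullback_attractor_def compact_imp_closed)
  ultimately show "y \<in> A \<tau> \<omega>" by simp
qed

text \<open>The distance to an image is an infimum of a continuous function over a random set,
  evaluated at the shifted sample point \<open>\<theta> (- t) \<omega>\<close>; the image need not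
  be closed for this.\<close>

lemma measurable_infdist_pull:
  assumes K: "measurable_family (completion M) K" and t: "0 \<le> t"
  shows "(\<lambda>\<omega>. infdist x (pull K t \<tau> \<omega>)) \<in> borel_measurable (completion M)"
proof -
  \<comment> \<open>Joint measurability of \<open>\<Phi>\<close> is given for a fixed initial time;
    here that time is \<open>\<tau> - t\<close>, independent of \<open>\<omega>\<close>.\<close>
  define \<sigma> where "\<sigma> = \<tau> - t"
  obtain D :: "ell2 set" where D: "countable D" "closure D = UNIV"
    using ell2_separable by blast
  have "(\<lambda>\<omega>. INF u\<in>K \<sigma> \<omega>. dist x (\<Phi> t \<sigma> \<omega> u)) \<in> borel_measurable (completion M)"
  proof (rule borel_measurable_INF_random_set[OF D])
    fix u :: ell2
    have \<Phi>: "(\<lambda>(t, \<omega>, u). \<Phi> t \<sigma> \<omega> u) \<in> restrict_space borel {0..} \<Otimes>\<^sub>M (M \<Otimes>\<^sub>M borel) \<rightarrow>\<^sub>M borel"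
      using cocycle by (simp add: continuous_cocycle_def)
    have "(\<lambda>\<omega>. (t, \<omega>, u)) \<in> M \<rightarrow>\<^sub>M restrict_space borel {0..} \<Otimes>\<^sub>M (M \<Otimes>\<^sub>M borel)"
      using t by (intro measurable_Pair measurable_const measurable_ident_sets)
        (auto simp: space_restrict_space)
    from measurable_compose[OF this \<Phi>] have "(\<lambda>\<omega>. \<Phi> t \<sigma> \<omega> u) \<in> M \<rightarrow>\<^sub>M borel"
      by simp
    moreover have "dist x \<in> borel \<rightarrow>\<^sub>M borel"
      by (intro borel_measurable_continuous_onI continuous_intros)
    ultimately have "(\<lambda>\<omega>. dist x (\<Phi> t \<sigma> \<omega> u)) \<in> borel_measurable M"
      by (rule measurable_compose)
    then show "(\<lambda>\<omega>. dist x (\<Phi> t \<sigma> \<omega> u)) \<in> borel_measurable (completion M)"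
      by (rule measurable_completion)
  next
    fix \<omega> assume "\<omega> \<in> space (completion M)"
    then show "continuous_on UNIV (\<lambda>u. dist x (\<Phi> t \<sigma> \<omega> u))" "K \<sigma> \<omega> \<noteq> {}"
      using cocycle_continuous[OF _ t] K
      by (auto simp: measurable_family_def intro!: continuous_intros)
  qed (use K in \<open>auto simp: measurable_family_def\<close>)
  moreover have "\<theta> (- t) \<in> completion M \<rightarrow>\<^sub>M completion M"
    using pds measurable_shift
    by (intro measurable_completion_of_measure_preserving)
      (simp_all add: parametric_dynamical_system_def)
  ultimately have
    "(\<lambda>\<omega>. INF u\<in>K \<sigma> (\<theta> (- t) \<omega>). dist x (\<Phi> t \<sigma> (\<theta> (- t) \<omega>) u)) \<in> borel_measurable (completion M)"
    by (rule measurable_compose[rotated])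
  moreover have "infdist x (pull K t \<tau> \<omega>) = (INF u\<in>K \<sigma> (\<theta> (- t) \<omega>). dist x (\<Phi> t \<sigma> (\<theta> (- t) \<omega>) u))"
    if "\<omega> \<in> space (completion M)" for \<omega>
  proof -
    have "K \<sigma> (\<theta> (- t) \<omega>) \<noteq> {}" using K that by (auto simp: measurable_family_def)
    then show ?thesis
      by (simp add: pullback_image_def infdist_notempty image_image \<sigma>_def)
  qed
  ultimately show ?thesis by (subst measurable_cong)
qed

end

section \<open>The attractor\<close>

locale absorbing_null_cocycle = continuous_cocycle_system M \<theta> \<Phi>
  for M :: "'w measure" and \<theta> and \<Phi> +
  fixes K :: "'w family"
  assumes absorbing: "closed_measurable_pullback_absorbing_set M \<theta> \<Phi> K"
    and null: "asymptotically_null M \<theta> \<Phi> K"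
begin

abbreviation "A \<equiv> omega_limit \<theta> \<Phi> K"

lemma K_tempered: "K \<in> \<D>"
  using absorbing by (simp add: closed_measurable_pullback_absorbing_set_def)

lemma K_measurable: "measurable_family (completion M) K"
  using absorbing by (simp add: closed_measurable_pullback_absorbing_set_def)

lemma K_bounded: "\<omega> \<in> space M \<Longrightarrow> bounded (K \<tau> \<omega>)"
  and K_closed: "\<omega> \<in> space M \<Longrightarrow> closed (K \<tau> \<omega>)"
  and K_nonempty: "\<omega> \<in> space M \<Longrightarrow> K \<tau> \<omega> \<noteq> {}"
  using K_tempered K_measurable by (simp_all add: tempered_families_def measurable_family_def)

lemma eventually_pull_subset_K:
  assumes "\<omega> \<in> space M" "B \<in> \<D>"
  shows "\<forall>\<^sub>F t in at_top. pull B t \<tau> \<omega> \<subseteq> K \<tau> \<omega>"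
  using absorbing assms
  unfolding closed_measurable_pullback_absorbing_set_def eventually_at_top_linorder by meson

text \<open>Absorption is applied over the earlier fibre
  \<open>(\<tau> - s, \<theta> (- s) \<omega>)\<close>, and the resulting inclusion in
  \<open>K\<close> is mapped forward by time \<open>s\<close>.\<close>

lemma eventually_pull_subset_pull_K:
  assumes \<omega>: "\<omega> \<in> space M" and B: "B \<in> \<D>" and s: "0 \<le> s"
  shows "\<forall>\<^sub>F t in at_top. pull B t \<tau> \<omega> \<subseteq> pull K s \<tau> \<omega>"
proof -
  obtain S where S: "\<And>t. S \<le> t \<Longrightarrow> pull B t (\<tau> - s) (\<theta> (- s) \<omega>) \<subseteq> K (\<tau> - s) (\<theta> (- s) \<omega>)"
    using eventually_pull_subset_K[OF shift_space[OF \<omega>] B, of "\<tau> - s" "- s"]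
    unfolding eventually_at_top_linorder by blast
  have "pull B t \<tau> \<omega> \<subseteq> pull K s \<tau> \<omega>" if "max s (S + s) \<le> t" for t
  proof -
    have "pull B t \<tau> \<omega> = \<Phi> s (\<tau> - s) (\<theta> (- s) \<omega>) ` pull B (t - s) (\<tau> - s) (\<theta> (- s) \<omega>)"
      using that s by (intro pull_split[OF \<omega>]) auto
    also have "\<dots> \<subseteq> pull K s \<tau> \<omega>"
      unfolding pullback_image_def[of _ _ K] using that by (intro image_mono S) auto
    finally show ?thesis .
  qed
  then show ?thesis unfolding eventually_at_top_linorder by blast
qed

lemma eventually_mem_pull_K:
  assumes "\<omega> \<in> space M" "B \<in> \<D>" "0 \<le> s"
    and t: "filterlim t at_top sequentially"
    and X: "\<forall>\<^sub>F n in sequentially. X n \<in> pull B (t n) \<tau> \<omega>"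
  shows "\<forall>\<^sub>F n in sequentially. X n \<in> pull K s \<tau> \<omega>"
  using X eventually_compose_filterlim[OF eventually_pull_subset_pull_K[OF assms(1-3)] t, of \<tau>]
  by eventually_elim blast

text \<open>The definition only offers closures of unions over late times, but from some time on all
  images of \<open>K\<close> lie in the single image at time \<open>s\<close>.\<close>

lemma A_subset_closure_pull:
  assumes "\<omega> \<in> space M" "0 \<le> s"
  shows "A \<tau> \<omega> \<subseteq> closure (pull K s \<tau> \<omega>)"
proof -
  obtain S where S: "\<And>t. S \<le> t \<Longrightarrow> pull K t \<tau> \<omega> \<subseteq> pull K s \<tau> \<omega>"
    using eventually_pull_subset_pull_K[OF assms(1) K_tempered assms(2), of \<tau>]
    unfolding eventually_at_top_linorder by blast
  have "A \<tau> \<omega> \<subseteq> closure (\<Union>t\<in>{S..}. pull K t \<tau> \<omega>)"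
    unfolding omega_limit_def by blast
  also have "\<dots> \<subseteq> closure (pull K s \<tau> \<omega>)"
    using S by (intro closure_mono UN_least) auto
  finally show ?thesis .
qed

lemma A_subset_K:
  assumes "\<omega> \<in> space M"
  shows "A \<tau> \<omega> \<subseteq> K \<tau> \<omega>"
proof -
  obtain S where S: "\<And>t. S \<le> t \<Longrightarrow> pull K t \<tau> \<omega> \<subseteq> K \<tau> \<omega>"
    using eventually_pull_subset_K[OF assms K_tempered, of \<tau>]
    unfolding eventually_at_top_linorder by blast
  have "A \<tau> \<omega> \<subseteq> closure (pull K (max S 0) \<tau> \<omega>)"
    by (rule A_subset_closure_pull[OF assms]) simp
  also have "\<dots> \<subseteq> K \<tau> \<omega>"
    by (intro closure_minimal S K_closed[OF assms]) simp
  finally show ?thesis .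
qed

lemma A_closed: "closed (A \<tau> \<omega>)"
  unfolding omega_limit_def by auto

text \<open>Late points of any tempered \<open>B\<close> lie in every image of \<open>K\<close>, so
  their limits fall into the omega-limit set of \<open>K\<close>, not merely that of
  \<open>B\<close>.\<close>

lemma limit_in_A:
  assumes "\<omega> \<in> space M" "B \<in> \<D>" "filterlim t at_top sequentially"
    and "\<forall>\<^sub>F n in sequentially. X n \<in> pull B (t n) \<tau> \<omega>" and l: "X \<longlonglongrightarrow> l"
  shows "l \<in> A \<tau> \<omega>"
  unfolding omega_limit_def
proof (rule INT_I)
  fix s
  \<comment> \<open>\<open>s\<close> may be negative, while inclusion into an image of
    \<open>K\<close> is available for nonnegative times.\<close>
  have "\<forall>\<^sub>F n in sequentially. X n \<in> pull K (max s 0) \<tau> \<omega>"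
    by (rule eventually_mem_pull_K[OF assms(1,2) _ assms(3,4)]) simp
  then have "\<forall>\<^sub>F n in sequentially. X n \<in> closure (\<Union>t\<in>{s..}. pull K t \<tau> \<omega>)"
  proof eventually_elim
    case (elim n)
    then have "X n \<in> (\<Union>t\<in>{s..}. pull K t \<tau> \<omega>)" by (intro UN_I[of "max s 0"]) auto
    then show ?case by (rule subsetD[OF closure_subset])
  qed
  then show "l \<in> closure (\<Union>t\<in>{s..}. pull K t \<tau> \<omega>)"
    by (rule Lim_in_closed_set[OF closed_closure _ sequentially_bot l])
qed

definition null_time :: "real \<Rightarrow> bool" where
  "null_time \<tau> \<longleftrightarrow> (\<forall>\<omega>\<in>space M. \<forall>\<epsilon>>0. \<exists>S>0. \<exists>I. tail_bound \<theta> \<Phi> K \<epsilon> \<tau> \<omega> S I)"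

lemma AE_null_time: "AE \<tau> in lborel. null_time \<tau>"
  using null unfolding asymptotically_null_def null_time_def .

text \<open>The norm bound comes from \<open>K\<close> and the tail bound from the image of
  \<open>K\<close> at the single time \<open>S\<close>; neither set alone provides both. Membership
  of \<open>X n\<close> is asked only eventually because the sequence it is applied to is meaningful
  only for large \<open>n\<close>.\<close>

lemma convergent_subseq_at_null_time:
  assumes \<tau>: "null_time \<tau>" and \<omega>: "\<omega> \<in> space M" and B: "B \<in> \<D>"
    and t: "filterlim t at_top sequentially"
    and X: "\<forall>\<^sub>F n in sequentially. X n \<in> pull B (t n) \<tau> \<omega>"
  obtains l \<rho> where "strict_mono \<rho>" "(X \<circ> \<rho>) \<longlonglongrightarrow> l"
proof -
  obtain r where r: "\<And>u. u \<in> K \<tau> \<omega> \<Longrightarrow> norm u \<le> r"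
    using K_bounded[OF \<omega>] unfolding bounded_iff by blast
  have bound: "\<forall>\<^sub>F n in sequentially. norm (X n) \<le> r"
    using X eventually_compose_filterlim[OF eventually_pull_subset_K[OF \<omega> B] t, of \<tau>]
    by eventually_elim (use r in blast)
  have tails: "\<exists>I. \<forall>\<^sub>F n in sequentially. tail_sq I (X n) \<le> \<epsilon>\<^sup>2" if \<epsilon>: "0 < \<epsilon>" for \<epsilon>
  proof -
    obtain S I where S: "0 < S" "tail_bound \<theta> \<Phi> K \<epsilon> \<tau> \<omega> S I"
      using \<tau> \<omega> \<epsilon> unfolding null_time_def by meson
    have "\<forall>\<^sub>F n in sequentially. X n \<in> pull K S \<tau> \<omega>"
      by (rule eventually_mem_pull_K[OF \<omega> B _ t X]) (use S(1) in simp)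
    then have "\<forall>\<^sub>F n in sequentially. tail_sq I (X n) \<le> \<epsilon>\<^sup>2"
      by eventually_elim (rule tail_boundD[OF S(2) order_refl])
    then show ?thesis ..
  qed
  show thesis
    by (rule convergent_subseq_of_small_tails[OF bound tails]) (simp, rule that)
qed

text \<open>
  An arbitrary \<open>\<tau>\<close> is reached from an earlier time at which the tails are small, and the continuous
  map in between preserves convergence of subsequences.
\<close>

lemma convergent_subseq:
  assumes \<omega>: "\<omega> \<in> space M" and B: "B \<in> \<D>"
    and t: "filterlim t at_top sequentially"
    and X: "\<And>n. X n \<in> pull B (t n) \<tau> \<omega>"
  obtains l \<rho> where "strict_mono \<rho>" "(X \<circ> \<rho>) \<longlonglongrightarrow> l" "l \<in> A \<tau> \<omega>"
proof -
  obtain \<tau>' where \<tau>': "\<tau>' < \<tau>" "null_time \<tau>'"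
    using AE_lborel_dense[OF AE_null_time, of "\<tau> - 1" \<tau>] by auto
  define s where "s = \<tau> - \<tau>'"
  have s: "0 \<le> s" and \<tau>_s: "\<tau> - s = \<tau>'" using \<tau>'(1) by (simp_all add: s_def)
  let ?\<omega>' = "\<theta> (- s) \<omega>"
  \<comment> \<open>A preimage at time \<open>\<tau>'\<close> exists only once \<open>t n\<close>
    has reached \<open>s\<close>; earlier values of \<open>Y\<close> are arbitrary.\<close>
  have "\<exists>y. s \<le> t n \<longrightarrow> y \<in> pull B (t n - s) \<tau>' ?\<omega>' \<and> X n = \<Phi> s \<tau>' ?\<omega>' y" for n
    using X[of n] pull_split[OF \<omega> s, of "t n" B \<tau>] unfolding \<tau>_s by blast
  then obtain Y where Y: "\<And>n. s \<le> t n \<Longrightarrow> Y n \<in> pull B (t n - s) \<tau>' ?\<omega>'"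
    "\<And>n. s \<le> t n \<Longrightarrow> X n = \<Phi> s \<tau>' ?\<omega>' (Y n)"
    by metis
  have large: "\<forall>\<^sub>F n in sequentially. s \<le> t n"
    using t unfolding filterlim_at_top by blast
  have "filterlim (\<lambda>n. t n - s) at_top sequentially"
    using filterlim_tendsto_add_at_top[OF tendsto_const t, of "- s"] by simp
  moreover have "\<forall>\<^sub>F n in sequentially. Y n \<in> pull B (t n - s) \<tau>' ?\<omega>'"
    using large by eventually_elim (rule Y(1))
  ultimately obtain l \<rho> where \<rho>: "strict_mono \<rho>" and l: "(Y \<circ> \<rho>) \<longlonglongrightarrow> l"
    by (rule convergent_subseq_at_null_time[OF \<tau>'(2) shift_space[OF \<omega>] B])
  have "(\<lambda>n. \<Phi> s \<tau>' ?\<omega>' ((Y \<circ> \<rho>) n)) \<longlonglongrightarrow> \<Phi> s \<tau>' ?\<omega>' l"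
    by (rule cocycle_tendsto[OF shift_space[OF \<omega>] s l])
  moreover have "\<forall>\<^sub>F n in sequentially. \<Phi> s \<tau>' ?\<omega>' ((Y \<circ> \<rho>) n) = (X \<circ> \<rho>) n"
    using eventually_compose_filterlim[OF large filterlim_subseq[OF \<rho>]]
    by eventually_elim (simp add: Y(2))
  ultimately have lim: "(X \<circ> \<rho>) \<longlonglongrightarrow> \<Phi> s \<tau>' ?\<omega>' l"
    by (rule Lim_transform_eventually)
  moreover have "filterlim (t \<circ> \<rho>) at_top sequentially"
    using filterlim_compose[OF t filterlim_subseq[OF \<rho>]] by (simp add: o_def)
  then have "\<Phi> s \<tau>' ?\<omega>' l \<in> A \<tau> \<omega>"
    by (rule limit_in_A[OF \<omega> B _ _ lim]) (simp add: X)
  ultimately show thesis using \<rho> that by blast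
qed

text \<open>The \<open>n\<close>-th point is replaced by a nearby point of \<open>pull K n\<close>;
  these have a subsequence with limit in \<open>A\<close>, and the vanishing error passes it
  back.\<close>

lemma A_compact:
  assumes "\<omega> \<in> space M"
  shows "compact (A \<tau> \<omega>)"
  unfolding compact_def
proof (intro allI impI)
  fix x :: "nat \<Rightarrow> ell2" assume "\<forall>n. x n \<in> A \<tau> \<omega>"
  then have "x n \<in> closure (pull K (real n) \<tau> \<omega>)" for n
    using A_subset_closure_pull[OF assms, of "real n" \<tau>] by auto
  then obtain X where X: "\<And>n. X n \<in> pull K (real n) \<tau> \<omega>" "(\<lambda>n. dist (X n) (x n)) \<longlonglongrightarrow> 0"
    by (rule closure_sequence_near[where x = x and S = "\<lambda>n. pull K (real n) \<tau> \<omega>"]) (rule that)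
  from X(1) obtain l \<rho> where \<rho>: "strict_mono \<rho>" "(X \<circ> \<rho>) \<longlonglongrightarrow> l" "l \<in> A \<tau> \<omega>"
    by (rule convergent_subseq[OF assms K_tempered filterlim_real_sequentially])
  have "(\<lambda>n. (X \<circ> \<rho>) n - (x \<circ> \<rho>) n) \<longlonglongrightarrow> 0"
    by (rule tendsto_norm_zero_cancel)
      (use LIMSEQ_subseq_LIMSEQ[OF X(2) \<rho>(1)] in \<open>simp add: o_def dist_norm\<close>)
  from tendsto_diff[OF \<rho>(2) this] have "(x \<circ> \<rho>) \<longlonglongrightarrow> l" by (simp add: o_def)
  with \<rho> show "\<exists>l\<in>A \<tau> \<omega>. \<exists>\<rho>. strict_mono \<rho> \<and> (x \<circ> \<rho>) \<longlonglongrightarrow> l" by blast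
qed

lemma A_nonempty:
  assumes "\<omega> \<in> space M"
  shows "A \<tau> \<omega> \<noteq> {}"
proof -
  have "\<exists>x. x \<in> pull K (real n) \<tau> \<omega>" for n
    using K_nonempty[OF shift_space[OF assms]] by (auto simp: pullback_image_def ex_in_conv)
  then obtain X where "\<And>n. X n \<in> pull K (real n) \<tau> \<omega>" by metis
  then show ?thesis
    using convergent_subseq[OF assms K_tempered filterlim_real_sequentially] by blast
qed

lemma A_tempered: "A \<in> \<D>"
proof -
  have "((\<lambda>s. exp (- \<gamma> * s) * (set_norm (A (\<tau> - s) (\<theta> (- s) \<omega>)))\<^sup>2) \<longlongrightarrow> 0) at_top"
    if \<omega>: "\<omega> \<in> space M" and "0 < \<gamma>" for \<tau> \<omega> \<gamma>
  proof (rule tendsto_sandwich[OF _ _ tendsto_const])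
    show "((\<lambda>s. exp (- \<gamma> * s) * (set_norm (K (\<tau> - s) (\<theta> (- s) \<omega>)))\<^sup>2) \<longlongrightarrow> 0) at_top"
      using K_tempered that by (simp add: tempered_families_def)
    have "0 \<le> set_norm (A (\<tau> - s) (\<theta> (- s) \<omega>))" for s
    proof -
      obtain u where "u \<in> A (\<tau> - s) (\<theta> (- s) \<omega>)" using A_nonempty[OF shift_space[OF \<omega>]] by blast
      then show ?thesis
        using norm_le_set_norm compact_imp_bounded[OF A_compact[OF shift_space[OF \<omega>]]]
        by (meson norm_ge_zero order_trans)
    qed
    then show "\<forall>\<^sub>F s in at_top. exp (- \<gamma> * s) * (set_norm (A (\<tau> - s) (\<theta> (- s) \<omega>)))\<^sup>2
        \<le> exp (- \<gamma> * s) * (set_norm (K (\<tau> - s) (\<theta> (- s) \<omega>)))\<^sup>2"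
      by (intro always_eventually allI mult_left_mono power_mono set_norm_mono
          A_subset_K A_nonempty K_bounded shift_space \<omega>) auto
  qed simp
  then show ?thesis
    by (simp add: tempered_families_def A_nonempty compact_imp_bounded A_compact)
qed

text \<open>Forward, points approximating \<open>x\<close> are pushed by time \<open>s\<close> into
  later images. Backward, points approximating \<open>y\<close> are lifted to the fibre at
  \<open>\<tau>\<close>.\<close>

lemma A_invariant:
  assumes \<omega>: "\<omega> \<in> space M" and s: "0 \<le> s"
  shows "\<Phi> s \<tau> \<omega> ` A \<tau> \<omega> = A (\<tau> + s) (\<theta> s \<omega>)"
proof (intro equalityI subsetI)
  fix y assume "y \<in> \<Phi> s \<tau> \<omega> ` A \<tau> \<omega>"
  then obtain x where x: "x \<in> A \<tau> \<omega>" "y = \<Phi> s \<tau> \<omega> x" by blast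
  have "x \<in> closure (pull K (real n) \<tau> \<omega>)" for n
    using A_subset_closure_pull[OF \<omega>, of "real n" \<tau>] x(1) by auto
  then obtain X where X: "\<And>n. X n \<in> pull K (real n) \<tau> \<omega>" "(\<lambda>n. dist (X n) x) \<longlonglongrightarrow> 0"
    by (rule closure_sequence_near[where x = "\<lambda>_. x" and S = "\<lambda>n. pull K (real n) \<tau> \<omega>"]) (rule that)
  have "(\<lambda>n. \<Phi> s \<tau> \<omega> (X n)) \<longlonglongrightarrow> y"
    unfolding x(2) using X(2)[folded tendsto_dist_iff] by (rule cocycle_tendsto[OF \<omega> s])
  moreover have "\<Phi> s \<tau> \<omega> (X n) \<in> pull K (real n + s) (\<tau> + s) (\<theta> s \<omega>)" for n
    using X(1) by (simp add: pull_forward[OF \<omega> s])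
  moreover have "filterlim (\<lambda>n. real n + s) at_top sequentially"
    by (rule filterlim_at_top_mono[OF filterlim_real_sequentially]) (simp add: s)
  ultimately show "y \<in> A (\<tau> + s) (\<theta> s \<omega>)"
    by (intro limit_in_A[OF shift_space[OF \<omega>] K_tempered]) auto
next
  fix y assume y: "y \<in> A (\<tau> + s) (\<theta> s \<omega>)"
  have "y \<in> closure (pull K (real n + s) (\<tau> + s) (\<theta> s \<omega>))" for n
    using A_subset_closure_pull[OF shift_space[OF \<omega>], of "real n + s" "\<tau> + s" s] y s by auto
  then obtain Y where Y: "\<And>n. Y n \<in> pull K (real n + s) (\<tau> + s) (\<theta> s \<omega>)"
    "(\<lambda>n. dist (Y n) y) \<longlonglongrightarrow> 0"
    by (rule closure_sequence_near[where x = "\<lambda>_. y"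
          and S = "\<lambda>n. pull K (real n + s) (\<tau> + s) (\<theta> s \<omega>)"]) (rule that)
  \<comment> \<open>The lifts need not converge, as the map has no continuous inverse in general;
    asymptotic compactness supplies a limit along a subsequence.\<close>
  have "\<exists>x\<in>pull K (real n) \<tau> \<omega>. Y n = \<Phi> s \<tau> \<omega> x" for n
    using Y(1)[of n] by (auto simp: pull_forward[OF \<omega> s])
  then obtain X where X: "\<And>n. X n \<in> pull K (real n) \<tau> \<omega>" "\<And>n. Y n = \<Phi> s \<tau> \<omega> (X n)"
    by metis
  from X(1) obtain l \<rho> where \<rho>: "strict_mono \<rho>" "(X \<circ> \<rho>) \<longlonglongrightarrow> l" "l \<in> A \<tau> \<omega>"
    by (rule convergent_subseq[OF \<omega> K_tempered filterlim_real_sequentially])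
  have "(Y \<circ> \<rho>) \<longlonglongrightarrow> \<Phi> s \<tau> \<omega> l"
    using cocycle_tendsto[OF \<omega> s \<rho>(2)] by (simp add: o_def X(2))
  moreover have "(Y \<circ> \<rho>) \<longlonglongrightarrow> y"
    using Y(2)[folded tendsto_dist_iff] \<rho>(1) by (rule LIMSEQ_subseq_LIMSEQ)
  ultimately have "y = \<Phi> s \<tau> \<omega> l" by (rule LIMSEQ_unique[rotated])
  then show "y \<in> \<Phi> s \<tau> \<omega> ` A \<tau> \<omega>" using \<rho>(3) by blast
qed

text \<open>Points that stay \<open>e\<close> away from \<open>A\<close> along times tending to
  infinity would have a subsequential limit in \<open>A\<close>.\<close>

lemma A_attracts:
  assumes \<omega>: "\<omega> \<in> space M" and B: "B \<in> \<D>"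
  shows "((\<lambda>t. hausdorff_semidist (pull B t \<tau> \<omega>) (A \<tau> \<omega>)) \<longlongrightarrow> 0) at_top"
proof (rule tendsto_zero_ennrealI)
  fix e :: real assume e: "0 < e"
  have "\<forall>\<^sub>F t in at_top. \<forall>y\<in>pull B t \<tau> \<omega>. \<exists>z\<in>A \<tau> \<omega>. dist y z < e"
  proof (rule ccontr)
    assume "\<not> ?thesis"
    then have "\<exists>t y. real n \<le> t \<and> y \<in> pull B t \<tau> \<omega> \<and> (\<forall>z\<in>A \<tau> \<omega>. \<not> dist y z < e)" for n
      unfolding eventually_at_top_linorder by blast
    then obtain t X where t: "\<And>n. real n \<le> t n" and X: "\<And>n. X n \<in> pull B (t n) \<tau> \<omega>"
      and far: "\<And>n z. z \<in> A \<tau> \<omega> \<Longrightarrow> \<not> dist (X n) z < e"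
      by metis
    have "filterlim t at_top sequentially"
      by (rule filterlim_at_top_mono[OF filterlim_real_sequentially]) (simp add: t)
    then obtain l \<rho> where "(X \<circ> \<rho>) \<longlonglongrightarrow> l" "l \<in> A \<tau> \<omega>"
      by (rule convergent_subseq[OF \<omega> B _ X])
    then show False
      using tendstoD[OF _ e, of "X \<circ> \<rho>" l sequentially] far[of l]
      by (auto simp: eventually_sequentially)
  qed
  then show "\<forall>\<^sub>F t in at_top. hausdorff_semidist (pull B t \<tau> \<omega>) (A \<tau> \<omega>) \<le> ennreal e"
    by eventually_elim (rule hausdorff_semidist_le, blast)
qed

lemma A_measurable: "measurable_family (completion M) A"
proof -
  have "(\<lambda>\<omega>. infdist x (A \<tau> \<omega>)) \<in> borel_measurable (completion M)" for x \<tau>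
  proof (rule borel_measurable_LIMSEQ_real)
    show "(\<lambda>\<omega>. infdist x (pull K (real n) \<tau> \<omega>)) \<in> borel_measurable (completion M)" for n
      by (rule measurable_infdist_pull[OF K_measurable]) simp
    show "(\<lambda>n. infdist x (pull K (real n) \<tau> \<omega>)) \<longlonglongrightarrow> infdist x (A \<tau> \<omega>)"
      if "\<omega> \<in> space (completion M)" for \<omega>
    proof -
      have \<omega>: "\<omega> \<in> space M" using that by simp
      show ?thesis
      proof (rule tendsto_infdist_of_semidist[OF A_nonempty[OF \<omega>] A_subset_closure_pull[OF \<omega>]])
        show "(\<lambda>n. hausdorff_semidist (pull K (real n) \<tau> \<omega>) (A \<tau> \<omega>)) \<longlonglongrightarrow> 0"
          by (rule filterlim_compose[OF A_attracts[OF \<omega> K_tempered] filterlim_real_sequentially])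
      qed simp
    qed
  qed
  then show ?thesis by (simp add: measurable_family_def A_closed A_nonempty)
qed

lemma A_attractor: "pullback_attractor M \<theta> \<Phi> A"
  unfolding pullback_attractor_def
  using A_tempered A_measurable A_compact A_invariant A_attracts by blast

text \<open>Invariance writes \<open>A\<close> as its own pullback over time \<open>S\<close>, hence
  as part of \<open>pull K S\<close>, so the tail bound holds on \<open>A\<close> itself; the radius
  comes from \<open>A \<subseteq> K\<close>.\<close>

lemma kolmogorov_entropy_A_le:
  assumes \<omega>: "\<omega> \<in> space M" and \<epsilon>: "0 < \<epsilon>" and S: "0 < S"
    and tail: "tail_bound \<theta> \<Phi> K (\<epsilon> / 2) \<tau> \<omega> S I"
  shows "kolmogorov_entropy \<epsilon> (A \<tau> \<omega>) \<le> ereal (entropy_bound I (set_norm (K \<tau> \<omega>)) \<epsilon>)"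
proof (rule kolmogorov_entropy_le[OF \<epsilon>])
  obtain v where "v \<in> K \<tau> \<omega>" using K_nonempty[OF \<omega>] by blast
  from norm_le_set_norm[OF this K_bounded[OF \<omega>]] show "0 \<le> set_norm (K \<tau> \<omega>)"
    using norm_ge_zero order_trans by blast
  fix u assume u: "u \<in> A \<tau> \<omega>"
  then show "norm u \<le> set_norm (K \<tau> \<omega>)"
    using A_subset_K[OF \<omega>] norm_le_set_norm[OF _ K_bounded[OF \<omega>]] by blast
  have "A \<tau> \<omega> = pull A S \<tau> \<omega>" using pull_attractor[OF A_attractor \<omega>, of S] S by simp
  also have "\<dots> \<subseteq> pull K S \<tau> \<omega>"
    unfolding pullback_image_def by (intro image_mono A_subset_K shift_space \<omega>)
  finally show "tail_sq I u \<le> (\<epsilon> / 2)\<^sup>2"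
    using u tail_boundD[OF tail order_refl] by blast
qed

end

theorem theorem4p1:
  fixes M :: "'w measure"
    and \<theta> :: "real \<Rightarrow> 'w \<Rightarrow> 'w"
    and \<Phi> :: "real \<Rightarrow> real \<Rightarrow> 'w \<Rightarrow> ell2 \<Rightarrow> ell2"
    and K :: "real \<Rightarrow> 'w \<Rightarrow> ell2 set"
    and T :: "(real \<Rightarrow> 'w \<Rightarrow> ell2 set) \<Rightarrow> real \<Rightarrow> 'w \<Rightarrow> real"
  assumes "parametric_dynamical_system M \<theta>"
    and "continuous_cocycle M \<theta> \<Phi>"
    and "closed_measurable_pullback_absorbing_set M \<theta> \<Phi> K"
    and "AE \<tau> in lborel. \<forall>\<omega>\<in>space M. \<forall>B\<in>tempered_families M \<theta>.
           T B \<tau> \<omega> > 0 \<and> (\<forall>t\<ge>T B \<tau> \<omega>. pullback_image \<theta> \<Phi> B t \<tau> \<omega> \<subseteq> K \<tau> \<omega>)"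
    and "asymptotically_null M \<theta> \<Phi> K"
  shows "\<exists>A. pullback_attractor M \<theta> \<Phi> A \<and>
           (\<forall>A'. pullback_attractor M \<theta> \<Phi> A' \<longrightarrow> (\<forall>\<tau>. \<forall>\<omega>\<in>space M. A' \<tau> \<omega> = A \<tau> \<omega>)) \<and>
           (\<forall>\<tau>. \<forall>\<omega>\<in>space M.
              A \<tau> \<omega> = (\<Inter>s\<in>{T K \<tau> \<omega>..}. closure (\<Union>t\<in>{s..}. pullback_image \<theta> \<Phi> K t \<tau> \<omega>))) \<and>
           (AE \<tau> in lborel. \<forall>\<omega>\<in>space M. \<forall>\<epsilon>>0. \<exists>T\<^sub>0>0. \<exists>I\<^sub>0.
              tail_bound \<theta> \<Phi> K \<epsilon> \<tau> \<omega> T\<^sub>0 I\<^sub>0 \<and>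
              kolmogorov_entropy \<epsilon> (A \<tau> \<omega>) \<le> ereal (entropy_bound I\<^sub>0 (set_norm (K \<tau> \<omega>)) \<epsilon>)) \<and>
           (\<forall>\<tau>. \<forall>\<omega>\<in>space M. \<forall>\<epsilon>>0. \<forall>T\<^sub>0>0. \<forall>I\<^sub>0.
              tail_bound \<theta> \<Phi> K (\<epsilon> / 2) \<tau> \<omega> T\<^sub>0 I\<^sub>0 \<longrightarrow>
              kolmogorov_entropy \<epsilon> (A \<tau> \<omega>) \<le> ereal (entropy_bound I\<^sub>0 (set_norm (K \<tau> \<omega>)) \<epsilon>))"
proof (intro exI conjI)
  interpret absorbing_null_cocycle M \<theta> \<Phi> K
    by unfold_locales (fact assms)+
  show "pullback_attractor M \<theta> \<Phi> A" by (rule A_attractor)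
  show "\<forall>A'. pullback_attractor M \<theta> \<Phi> A' \<longrightarrow> (\<forall>\<tau>. \<forall>\<omega>\<in>space M. A' \<tau> \<omega> = A \<tau> \<omega>)"
    using pullback_attractor_subset A_attractor by (meson subset_antisym)
  show "\<forall>\<tau>. \<forall>\<omega>\<in>space M.
      A \<tau> \<omega> = (\<Inter>s\<in>{T K \<tau> \<omega>..}. closure (\<Union>t\<in>{s..}. pullback_image \<theta> \<Phi> K t \<tau> \<omega>))"
    by (intro allI ballI omega_limit_from)
  show "\<forall>\<tau>. \<forall>\<omega>\<in>space M. \<forall>\<epsilon>>0. \<forall>T\<^sub>0>0. \<forall>I\<^sub>0.
      tail_bound \<theta> \<Phi> K (\<epsilon> / 2) \<tau> \<omega> T\<^sub>0 I\<^sub>0 \<longrightarrow>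
      kolmogorov_entropy \<epsilon> (A \<tau> \<omega>) \<le> ereal (entropy_bound I\<^sub>0 (set_norm (K \<tau> \<omega>)) \<epsilon>)"
    using kolmogorov_entropy_A_le by blast
  show "AE \<tau> in lborel. \<forall>\<omega>\<in>space M. \<forall>\<epsilon>>0. \<exists>T\<^sub>0>0. \<exists>I\<^sub>0.
      tail_bound \<theta> \<Phi> K \<epsilon> \<tau> \<omega> T\<^sub>0 I\<^sub>0 \<and>
      kolmogorov_entropy \<epsilon> (A \<tau> \<omega>) \<le> ereal (entropy_bound I\<^sub>0 (set_norm (K \<tau> \<omega>)) \<epsilon>)"
    using AE_null_time
  proof (rule AE_mp, intro AE_I2 impI ballI allI)
    fix \<tau> \<omega> and \<epsilon> :: real
    assume \<tau>: "null_time \<tau>" and \<omega>: "\<omega> \<in> space M" and \<epsilon>: "0 < \<epsilon>"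
    \<comment> \<open>The index is chosen at the finer level \<open>\<epsilon> / 2\<close>, where
      the entropy bound applies; the same index and time are admissible at level
      \<open>\<epsilon>\<close>.\<close>
    then obtain S I where S: "0 < S" "tail_bound \<theta> \<Phi> K (\<epsilon> / 2) \<tau> \<omega> S I"
      unfolding null_time_def by (meson half_gt_zero)
    moreover have "tail_bound \<theta> \<Phi> K \<epsilon> \<tau> \<omega> S I"
      using tail_bound_mono[OF S(2)] \<epsilon> by simp
    ultimately show "\<exists>T\<^sub>0>0. \<exists>I\<^sub>0. tail_bound \<theta> \<Phi> K \<epsilon> \<tau> \<omega> T\<^sub>0 I\<^sub>0 \<and>
        kolmogorov_entropy \<epsilon> (A \<tau> \<omega>) \<le> ereal (entropy_bound I\<^sub>0 (set_norm (K \<tau> \<omega>)) \<epsilon>)"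
      using kolmogorov_entropy_A_le[OF \<omega> \<epsilon>] by blast
  qed
qed

end
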